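(* Let $\alpha>\beta\ge0$ and let $\mathbb I=(\mathcal B_1,\dots,\mathcal B_n,\mathcal F)$ be an instance of matroid-max-PBOI in which every box $\mathcal B_i$ admits an $(\alpha,\beta)$-semilocal approximation under some probability $p_i\in[0,1]$. Then $\mathrm{CG}(\mathbb I)\ge\alpha-\beta$.
   Context: PBOI, maximization. Box $\mathcal B=(\mathcal D,c)$ has nonnegative value $X\sim\mathcal D$ (finite support), mean $\mu=\mathbb E[X]$, opening cost $c\ge0$; as an MDP it has two actions: "open" (cost $c$, terminal value $X$) and "grab" (cost $0$, terminal value $\mu$). Matroid-max-PBOI: given a matroid on $[n]$ with independent sets $\mathcal F$ and independent boxes $\mathcal B_1,\dots,\mathcal B_n$, a policy adaptively opens/grabs boxes and accepts boxes from terminal states keeping the accepted set in $\mathcal F$, and may stop any time; utility = accepted values minus costs; $\mathrm{OPT}(\mathbb I)$ = maximum expected utility. A commitment fixes for each box (possibly randomly) whether it is opened or grabbed; $\mathrm{CG}(\mathbb I)$ is the maximum over tuples of commitments of the optimal expected utility of the restricted instance divided by $\mathrm{OPT}(\mathbb I)$. Indices: $g$ solves $c=\mathbb E[(X-g)^+]$; $h'$ solves $c=\mathbb E[(h'-X)^+]$; $h=\max(\mu,h')$. A box is degenerate if $g<h'$; standing assumption: every degenerate box $(\mathcal D,c)$ has been replaced by the normalized box whose value is deterministically $\mu$ and whose cost is $0$ (so all boxes satisfy $h=h'\le\mu$, $c\le\mu\le g$, or are of that deterministic form). Surrogate values: $W^*_o=\min\{X,g\}$, $W^*_g=\mu$,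 $W^*=\max\{W^*_o,h\}$. A box admits an $(\alpha,\beta)$-semilocal approximation under $p\in[0,1]$ if for all $y\in\mathbb R$: $$(1-p)\,\mathbb E[\max\{W^*_o,y\}]+p\,\max\{\mu,y\}\ \ge\ \mathbb E[\max\{\alpha W^*,y\}]-p\beta\mu.$$
   Formalization: The source defines h = max(μ,h') but also asserts h = h' ≤ μ, which conflict; the formal theorem allows h = max(μ,h') for all α > β ≥ 0, and h = h' only when α ≤ 1, as the claim fails for α > 1 there. It also assumes OPT(I) ≠ 0, so that the ratio CG(I) is defined. *)

theory Defs
  imports "HOL-Probability.Probability"
begin

definition matroid :: "'a set \<Rightarrow> 'a set set \<Rightarrow> bool" where
  "matroid E F \<longleftrightarrow>
     finite E \<and> F \<subseteq> Pow E \<and> {} \<in> F \<and>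
     (\<forall>S\<in>F. \<forall>T\<subseteq>S. T \<in> F) \<and>
     (\<forall>S\<in>F. \<forall>T\<in>F. card S < card T \<longrightarrow> (\<exists>t\<in>T - S. insert t S \<in> F))"


section \<open>Boxes and their indices\<close>

record box =
  law :: "real pmf"
  cost :: real

definition wf_box :: "box \<Rightarrow> bool" where
  "wf_box b \<longleftrightarrow> finite (set_pmf (law b)) \<and> (\<forall>x\<in>set_pmf (law b). 0 \<le> x) \<and> 0 \<le> cost b"

definition mean :: "box \<Rightarrow> real" where
  "mean b = measure_pmf.expectation (law b) (\<lambda>x. x)"

text \<open>
  Both defining equations have a unique solution if the cost is positive. If the cost is 0, then
  \<open>g_index\<close> is an arbitrary number at or above the support and \<open>h'_index\<close> an arbitrary number at
  or below it; the choice affects neither degeneracy nor any of the surrogate values below.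
\<close>

definition g_index :: "box \<Rightarrow> real" where
  "g_index b = (SOME g. cost b = measure_pmf.expectation (law b) (\<lambda>x. max (x - g) 0))"

definition h'_index :: "box \<Rightarrow> real" where
  "h'_index b = (SOME h. cost b = measure_pmf.expectation (law b) (\<lambda>x. max (h - x) 0))"

definition degenerate :: "box \<Rightarrow> bool" where
  "degenerate b \<longleftrightarrow> g_index b < h'_index b"

definition normalized :: "box \<Rightarrow> bool" where
  "normalized b \<longleftrightarrow> \<not> degenerate b \<or> (law b = return_pmf (mean b) \<and> cost b = 0)"

text \<open>
  The index \<open>h\<close> entering \<open>W\<^sup>*\<close> is a parameter because two specifications of it have to be
  distinguished: \<open>h = max (mean b) (h'_index b)\<close>, and \<open>h = h'_index b\<close> for nondegenerate boxes.
  They do not agree: for a nondegenerate box the former is the mean, and \<open>h'_index b\<close> is at most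
  the mean. With the latter, \<open>(\<alpha>, \<beta>)\<close>-approximations are only useful for \<open>\<alpha> \<le> 1\<close>: every
  nondegenerate box with \<open>\<alpha> * h'_index b \<ge> mean b\<close>, \<open>\<alpha> \<ge> 1\<close> has one with \<open>\<beta> = \<alpha> - 1\<close> under
  \<open>p = 1\<close>, although the commitment gap of such boxes can be less than \<open>\<alpha> - \<beta> = 1\<close>.
\<close>

definition W_open :: "box \<Rightarrow> real \<Rightarrow> real" where
  "W_open b x = min x (g_index b)"

definition W_star :: "box \<Rightarrow> real \<Rightarrow> real \<Rightarrow> real" where
  "W_star b h x = max (W_open b x) h"

definition semilocal :: "box \<Rightarrow> real \<Rightarrow> real \<Rightarrow> real \<Rightarrow> real \<Rightarrow> bool" where
  "semilocal b h \<alpha> \<beta> p \<longleftrightarrow>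
     (\<forall>y::real.
        (1 - p) * measure_pmf.expectation (law b) (\<lambda>x. max (W_open b x) y) + p * max (mean b) y
        \<ge> measure_pmf.expectation (law b) (\<lambda>x. max (\<alpha> * W_star b h x) y) - p * \<beta> * mean b)"


section \<open>Policies\<close>

datatype action = Open | Grab

primrec action_cost :: "box \<Rightarrow> action \<Rightarrow> real" where
  "action_cost b Open = cost b"
| "action_cost b Grab = 0"

primrec outcome :: "box \<Rightarrow> action \<Rightarrow> real pmf" where
  "outcome b Open = law b"
| "outcome b Grab = return_pmf (mean b)"

text \<open>
  A policy is a decision tree, so every decision may depend on the whole history.
  \<open>Advance i q k\<close> draws an action from \<open>q\<close>, performs it on box \<open>i\<close>, and continues with \<open>k a x\<close>
  where \<open>a\<close> is the action drawn and \<open>x\<close> the terminal value obtained.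
\<close>

datatype policy =
    Stop
  | Accept nat policy
  | Advance nat "action pmf" "action \<Rightarrow> real \<Rightarrow> policy"

text \<open>
  \<open>C i\<close> is the set of admissible (distributions over) actions for box \<open>i\<close>; \<open>T\<close> is the set of
  boxes in a terminal state and \<open>A \<subseteq> T\<close> the set of accepted boxes.
\<close>

primrec feasible ::
  "nat set \<Rightarrow> nat set set \<Rightarrow> (nat \<Rightarrow> action pmf set) \<Rightarrow> policy \<Rightarrow> nat set \<Rightarrow> nat set \<Rightarrow> bool" where
  "feasible E F C Stop T A \<longleftrightarrow> True"
| "feasible E F C (Accept i k) T A \<longleftrightarrow>
     i \<in> T - A \<and> insert i A \<in> F \<and> feasible E F C k T (insert i A)"
| "feasible E F C (Advance i q k) T A \<longleftrightarrow>
     i \<in> E - T \<and> q \<in> C i \<and> (\<forall>a x. feasible E F C (k a x) (insert i T) A)"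

text \<open>
  Expected utility, where \<open>v i\<close> is the terminal value of box \<open>i\<close> once it has been advanced.
  In a feasible policy each box is advanced at most once on every path, hence drawing its value
  afresh at that node makes the boxes independent.
\<close>

primrec utility :: "(nat \<Rightarrow> box) \<Rightarrow> policy \<Rightarrow> (nat \<Rightarrow> real) \<Rightarrow> real" where
  "utility B Stop v = 0"
| "utility B (Accept i k) v = v i + utility B k v"
| "utility B (Advance i q k) v =
     measure_pmf.expectation q (\<lambda>a. - action_cost (B i) a +
       measure_pmf.expectation (outcome (B i) a) (\<lambda>x. utility B (k a x) (v(i := x))))"

text \<open>
  The supremum is a maximum: the supports are finite, so up to behaviour off the supports there
  are only finitely many feasible policies when all sets \<open>C i\<close> are finite.
\<close>

definition opt_value ::
  "nat set \<Rightarrow> nat set set \<Rightarrow> (nat \<Rightarrow> box) \<Rightarrow> (nat \<Rightarrow> action pmf set) \<Rightarrow> real" where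
  "opt_value E F B C = (SUP \<pi>\<in>{\<pi>. feasible E F C \<pi> {} {}}. utility B \<pi> (\<lambda>_. 0))"

definition OPT :: "nat set \<Rightarrow> nat set set \<Rightarrow> (nat \<Rightarrow> box) \<Rightarrow> real" where
  "OPT E F B = opt_value E F B (\<lambda>_. range return_pmf)"

text \<open>
  A commitment for a box is a distribution over its actions. In the restricted instance, advancing
  box \<open>i\<close> runs the committed (random) action, and there is no other way to advance it.
\<close>

definition OPT_committed ::
  "nat set \<Rightarrow> nat set set \<Rightarrow> (nat \<Rightarrow> box) \<Rightarrow> (nat \<Rightarrow> action pmf) \<Rightarrow> real" where
  "OPT_committed E F B c = opt_value E F B (\<lambda>i. {c i})"

definition CG :: "nat set \<Rightarrow> nat set set \<Rightarrow> (nat \<Rightarrow> box) \<Rightarrow> real" where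
  "CG E F B = (SUP c. OPT_committed E F B c / OPT E F B)"


section \<open>Well-definedness of the indices and of the optimal values\<close>

lemma g_index_solves:
  assumes "wf_box b"
  shows "cost b = measure_pmf.expectation (law b) (\<lambda>x. max (x - g_index b) 0)"
proof -
  define S where "S = set_pmf (law b)"
  define f where "f = (\<lambda>g. measure_pmf.expectation (law b) (\<lambda>x. max (x - g) 0))"
  have fin: "finite S" and c: "0 \<le> cost b" and nn: "\<And>x. x \<in> S \<Longrightarrow> 0 \<le> x" and ne: "S \<noteq> {}"
    using assms by (auto simp: wf_box_def S_def set_pmf_not_empty)
  have f_sum: "f g = (\<Sum>x\<in>S. pmf (law b) x * max (x - g) 0)" for g
    unfolding f_def using fin by (subst integral_measure_pmf[of S]) (auto simp: S_def)
  have tot: "(\<Sum>x\<in>S. pmf (law b) x) = 1"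
    using sum_pmf_eq_1[of S "law b"] fin by (simp add: S_def)
  have hi: "f (Max S) = 0"
    unfolding f_sum using fin by (intro sum.neutral) (auto simp: max_def)
  have "cost b = (\<Sum>x\<in>S. pmf (law b) x * cost b)"
    by (simp add: sum_distrib_right[symmetric] tot)
  also have "\<dots> \<le> f (- cost b)"
    unfolding f_sum
  proof (intro sum_mono mult_left_mono)
    show "cost b \<le> max (x - - cost b) 0" if "x \<in> S" for x
      using nn[OF that] by simp
  qed simp
  finally have lo: "cost b \<le> f (- cost b)" .
  have "- cost b \<le> Max S"
    using c nn[OF Max_in[OF fin ne]] by linarith
  moreover have "continuous_on {- cost b..Max S} f"
    unfolding f_sum[abs_def] by (intro continuous_intros)
  ultimately have "\<exists>g. f g = cost b"
    using IVT2'[of f "Max S" "cost b" "- cost b"] lo hi c by auto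
  then have "\<exists>g. cost b = f g" by metis
  then show ?thesis
    unfolding g_index_def f_def by (rule someI_ex)
qed

lemma h'_index_solves:
  assumes "wf_box b"
  shows "cost b = measure_pmf.expectation (law b) (\<lambda>x. max (h'_index b - x) 0)"
proof -
  define S where "S = set_pmf (law b)"
  define f where "f = (\<lambda>h. measure_pmf.expectation (law b) (\<lambda>x. max (h - x) 0))"
  have fin: "finite S" and c: "0 \<le> cost b" and nn: "\<And>x. x \<in> S \<Longrightarrow> 0 \<le> x" and ne: "S \<noteq> {}"
    using assms by (auto simp: wf_box_def S_def set_pmf_not_empty)
  have f_sum: "f h = (\<Sum>x\<in>S. pmf (law b) x * max (h - x) 0)" for h
    unfolding f_def using fin by (subst integral_measure_pmf[of S]) (auto simp: S_def)
  have tot: "(\<Sum>x\<in>S. pmf (law b) x) = 1"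
    using sum_pmf_eq_1[of S "law b"] fin by (simp add: S_def)
  have lo: "f 0 = 0"
    unfolding f_sum using nn by (intro sum.neutral) (auto simp: max_def)
  have "cost b = (\<Sum>x\<in>S. pmf (law b) x * cost b)"
    by (simp add: sum_distrib_right[symmetric] tot)
  also have "\<dots> \<le> f (Max S + cost b)"
    unfolding f_sum
  proof (intro sum_mono mult_left_mono)
    show "cost b \<le> max (Max S + cost b - x) 0" if "x \<in> S" for x
      using Max_ge[OF fin that] by simp
  qed simp
  finally have hi: "cost b \<le> f (Max S + cost b)" .
  have "0 \<le> Max S + cost b"
    using c nn[OF Max_in[OF fin ne]] by linarith
  moreover have "continuous_on {0..Max S + cost b} f"
    unfolding f_sum[abs_def] by (intro continuous_intros)
  ultimately have "\<exists>h. f h = cost b"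
    using IVT'[of f 0 "cost b" "Max S + cost b"] lo hi c by auto
  then have "\<exists>h. cost b = f h" by metis
  then show ?thesis
    unfolding h'_index_def f_def by (rule someI_ex)
qed

lemma expectation_le_const:
  fixes f :: "'a \<Rightarrow> real"
  assumes "finite (set_pmf p)" and "\<And>x. x \<in> set_pmf p \<Longrightarrow> f x \<le> M"
  shows "measure_pmf.expectation p f \<le> M"
proof -
  have "measure_pmf.expectation p f = (\<Sum>x\<in>set_pmf p. pmf p x * f x)"
    using assms(1) by (subst integral_measure_pmf[of "set_pmf p"]) auto
  also have "\<dots> \<le> (\<Sum>x\<in>set_pmf p. pmf p x * M)"
    using assms(2) by (intro sum_mono mult_left_mono) auto
  also have "\<dots> = M"
    using sum_pmf_eq_1[of "set_pmf p" p] assms(1) by (simp add: sum_distrib_right[symmetric])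
  finally show ?thesis .
qed

lemma utility_le:
  assumes E: "finite E"
    and wf: "\<And>i. i \<in> E \<Longrightarrow> wf_box (B i)"
    and M: "\<And>i a x. i \<in> E \<Longrightarrow> x \<in> set_pmf (outcome (B i) a) \<Longrightarrow> x \<le> M i"
    and M0: "\<And>i. i \<in> E \<Longrightarrow> 0 \<le> M i"
  shows "feasible E F C \<pi> T A \<Longrightarrow> T \<subseteq> E \<Longrightarrow> (\<And>i. i \<in> T \<Longrightarrow> v i \<le> M i) \<Longrightarrow>
         utility B \<pi> v \<le> (\<Sum>i\<in>E - A. M i)"
proof (induction \<pi> arbitrary: T A v)
  case Stop
  then show ?case using M0 by (auto intro: sum_nonneg)
next
  case (Accept i k)
  then have i: "i \<in> T" "i \<in> E" "i \<notin> A" by auto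
  have "utility B k v \<le> (\<Sum>j\<in>E - insert i A. M j)"
    by (rule Accept.IH[of T]) (use Accept.prems in auto)
  moreover have "(\<Sum>j\<in>E - A. M j) = M i + (\<Sum>j\<in>E - insert i A. M j)"
    using i E by (subst sum.remove[of _ i]) (auto intro!: sum.cong)
  moreover have "v i \<le> M i" using Accept.prems i by auto
  ultimately show ?case by simp
next
  case (Advance i q k)
  have i: "i \<in> E" using Advance.prems by auto
  have fo: "finite (set_pmf (outcome (B i) a))" for a
    using wf[OF i] by (cases a) (auto simp: wf_box_def)
  have fa: "finite (set_pmf q)"
  proof (rule finite_subset)
    show "set_pmf q \<subseteq> {Open, Grab}"
    proof
      fix a show "a \<in> {Open, Grab}" by (cases a) simp_all
    qed
  qed simp
  have c0: "0 \<le> action_cost (B i) a" for a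
    using wf[OF i] by (cases a) (auto simp: wf_box_def)
  have sub: "measure_pmf.expectation (outcome (B i) a) (\<lambda>x. utility B (k a x) (v(i := x)))
          \<le> (\<Sum>j\<in>E - A. M j)" for a
  proof (rule expectation_le_const[OF fo])
    fix x assume x: "x \<in> set_pmf (outcome (B i) a)"
    show "utility B (k a x) (v(i := x)) \<le> (\<Sum>j\<in>E - A. M j)"
    proof (rule Advance.IH[of "k a" "k a x" "insert i T"])
      show "feasible E F C (k a x) (insert i T) A" and "insert i T \<subseteq> E"
        using Advance.prems by auto
      show "(v(i := x)) j \<le> M j" if "j \<in> insert i T" for j
        using that Advance.prems(3) M[OF i x] by auto
    qed auto
  qed
  have "- action_cost (B i) a +
      measure_pmf.expectation (outcome (B i) a) (\<lambda>x. utility B (k a x) (v(i := x)))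
          \<le> (\<Sum>j\<in>E - A. M j)" for a
    using c0[of a] sub[of a] by linarith
  then show ?case
    by (simp add: expectation_le_const[OF fa])
qed

lemma bdd_above_utility:
  assumes "finite E" and "\<And>i. i \<in> E \<Longrightarrow> wf_box (B i)"
  shows "bdd_above ((\<lambda>\<pi>. utility B \<pi> (\<lambda>_. 0)) ` {\<pi>. feasible E F C \<pi> {} {}})"
proof -
  define M where "M i = Max (insert 0 (insert (mean (B i)) (set_pmf (law (B i)))))" for i
  have fin: "finite (insert 0 (insert (mean (B i)) (set_pmf (law (B i)))))" if "i \<in> E" for i
    using assms(2)[OF that] by (auto simp: wf_box_def)
  have "x \<le> M i" if "i \<in> E" "x \<in> set_pmf (outcome (B i) a)" for i a x
    unfolding M_def
  proof (rule Max_ge[OF fin[OF that(1)]])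
    show "x \<in> insert 0 (insert (mean (B i)) (set_pmf (law (B i))))"
      using that(2) by (cases a) auto
  qed
  moreover have "0 \<le> M i" if "i \<in> E" for i
    unfolding M_def by (rule Max_ge[OF fin[OF that]]) simp
  ultimately have "utility B \<pi> (\<lambda>_. 0) \<le> (\<Sum>i\<in>E - {}. M i)" if "feasible E F C \<pi> {} {}" for \<pi>
    using that assms by (intro utility_le[where T = "{}"]) auto
  then show ?thesis by (auto intro!: bdd_aboveI)
qed

end

theory Submission
  imports Defs
begin

text \<open>
  Policy by policy, the optimum is at most the expected maximum weight of an independent set under
  the surrogate values \<open>W\<^sup>*\<close>; for a deterministic commitment, the greedy index policy attains the
  corresponding expectation under the committed surrogate values. It remains to exchange
  \<open>\<alpha> * W\<^sup>*\<close> for committed surrogates one box at a time. As a function of one weight, the maximum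
  weight is constant or of the form \<open>c + max x y\<close>, so semilocality shows that opening is lossless or
  grabbing loses at most \<open>\<beta> * mean\<close>. Losing this for every box would be too much, hence boxes are
  treated by decreasing mean, and a box spanned by those already grabbed is always opened. The
  grabbed boxes then form an independent set, whose total mean is at most the optimum.

  If \<open>\<alpha> > 1\<close>, then \<open>h\<close> is the mean, and the approximation is also a \<open>(1, \<beta> - (\<alpha> - 1))\<close>-semilocal
  one.
\<close>

section \<open>Boxes\<close>

lemma integrable_law: "wf_box b \<Longrightarrow> integrable (measure_pmf (law b)) (f :: real \<Rightarrow> real)"
  by (simp add: wf_box_def integrable_measure_pmf_finite)

lemma mean_nonneg: "wf_box b \<Longrightarrow> 0 \<le> mean b"
  unfolding mean_def by (rule integral_nonneg_AE) (auto simp: wf_box_def AE_measure_pmf_iff)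

text \<open>A point mass of cost 0 turns the index equations into
  \<open>mean b \<le> g_index b\<close> and \<open>h'_index b \<le> mean b\<close>, whichever
  solutions \<open>SOME\<close> selects.\<close>

lemma normalized_indices:
  assumes "wf_box b" "normalized b"
  shows "h'_index b \<le> g_index b"
proof (cases "degenerate b")
  case True
  with assms(2) have d: "law b = return_pmf (mean b)" "cost b = 0"
    by (auto simp: normalized_def)
  from g_index_solves[OF assms(1)] h'_index_solves[OF assms(1)] show ?thesis
    by (subst (asm) (1 2) d(1)) (simp add: d(2) max_def split: if_splits)
qed (simp add: degenerate_def)

text \<open>Clipping from above at \<open>g_index b\<close> loses exactly the cost in expectation,
  and raising to \<open>h'_index b\<close> gains exactly the cost. The order of the indices lets
  \<open>W_star\<close> split into these two corrections.\<close>

lemma mean_W_star: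
  assumes "wf_box b" "normalized b"
  shows "measure_pmf.expectation (law b) (W_star b (h'_index b)) = mean b"
proof -
  have "W_star b (h'_index b) = (\<lambda>x. x - max (x - g_index b) 0 + max (h'_index b - x) 0)"
    using normalized_indices[OF assms] by (auto simp: W_star_def W_open_def fun_eq_iff)
  then show ?thesis
    using g_index_solves[OF assms(1)] h'_index_solves[OF assms(1)]
    by (simp add: integrable_law[OF assms(1)] mean_def)
qed

lemma h'_index_le_mean:
  assumes "wf_box b" "normalized b"
  shows "h'_index b \<le> mean b"
proof -
  have "measure_pmf.expectation (law b) (\<lambda>_. h'_index b)
      \<le> measure_pmf.expectation (law b) (W_star b (h'_index b))"
    by (intro integral_mono integrable_law assms) (auto simp: W_star_def)
  then show ?thesis by (simp add: mean_W_star[OF assms])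
qed

text \<open>Jensen's inequality for the convex function \<open>\<lambda>x. max x y\<close>, since
  \<open>W_star\<close> averages to the mean.\<close>

lemma grab_le_W_star:
  assumes "wf_box b" "normalized b"
  shows "max (mean b) y \<le> measure_pmf.expectation (law b) (\<lambda>x. max (W_star b (h'_index b) x) y)"
proof -
  have "measure_pmf.expectation (law b) (W_star b (h'_index b))
      \<le> measure_pmf.expectation (law b) (\<lambda>x. max (W_star b (h'_index b) x) y)"
    and "measure_pmf.expectation (law b) (\<lambda>_. y)
      \<le> measure_pmf.expectation (law b) (\<lambda>x. max (W_star b (h'_index b) x) y)"
    by (intro integral_mono integrable_law assms; simp)+
  then show ?thesis by (simp add: mean_W_star[OF assms])
qed

text \<open>The cost pays for one of the two clippings: for low \<open>y\<close> the raising to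
  \<open>h'_index b\<close>, which makes opening no better than grabbing; for high \<open>y\<close>
  the cut at \<open>g_index b\<close>, the floor being hidden by \<open>y\<close>.\<close>

lemma open_le_W_star:
  assumes "wf_box b" "normalized b"
  shows "measure_pmf.expectation (law b) (\<lambda>x. max x y) - cost b
      \<le> measure_pmf.expectation (law b) (\<lambda>x. max (W_star b (h'_index b) x) y)"
proof (cases "y \<le> h'_index b")
  case True
  have "measure_pmf.expectation (law b) (\<lambda>x. max x y)
      \<le> measure_pmf.expectation (law b) (\<lambda>x. x + max (h'_index b - x) 0)"
    using True by (intro integral_mono integrable_law assms) auto
  also have "\<dots> = mean b + cost b"
    using h'_index_solves[OF assms(1)] by (simp add: integrable_law[OF assms(1)] mean_def)
  finally show ?thesis using grab_le_W_star[OF assms, of y] by linarith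
next
  case False
  have "measure_pmf.expectation (law b) (\<lambda>x. max x y)
      \<le> measure_pmf.expectation (law b)
          (\<lambda>x. max (W_star b (h'_index b) x) y + max (x - g_index b) 0)"
    using False normalized_indices[OF assms]
    by (intro integral_mono integrable_law assms) (auto simp: W_star_def W_open_def)
  also have "\<dots> = measure_pmf.expectation (law b) (\<lambda>x. max (W_star b (h'_index b) x) y) + cost b"
    using g_index_solves[OF assms(1)] by (simp add: integrable_law[OF assms(1)])
  finally show ?thesis by linarith
qed

text \<open>The floor \<open>h'_index b\<close> is at most the mean and so disappears below
  \<open>y\<close>. Scaling by \<open>\<alpha>\<close> raises only negative values, and not beyond
  0, which is also at most \<open>y\<close>.\<close>

lemma open_lossless_above_mean:
  assumes "wf_box b" "normalized b" "mean b \<le> y" "0 \<le> \<alpha>" "\<alpha> \<le> 1"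
  shows "measure_pmf.expectation (law b) (\<lambda>x. max (\<alpha> * W_star b (h'_index b) x) y)
      \<le> measure_pmf.expectation (law b) (\<lambda>x. max (W_open b x) y)"
proof -
  have scale: "\<alpha> * z \<le> max z 0" for z
  proof (cases "0 \<le> z")
    case True
    then show ?thesis using mult_right_mono[OF assms(5) True] by simp
  next
    case False
    then show ?thesis using assms(4) by (simp add: mult_nonneg_nonpos)
  qed
  have "\<alpha> * W_star b (h'_index b) x \<le> max (W_open b x) y" for x
    using scale[of "W_star b (h'_index b) x"] mean_nonneg[OF assms(1)] assms(3)
      h'_index_le_mean[OF assms(1,2)]
    unfolding W_star_def by linarith
  then have "max (\<alpha> * W_star b (h'_index b) x) y \<le> max (W_open b x) y" for x
    by simp
  then show ?thesis
    by (intro integral_mono integrable_law assms)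
qed

section \<open>Changing the parameters of semilocal approximations\<close>

lemma semilocal_antimono:
  assumes "wf_box b" "semilocal b h \<alpha> \<beta> p" "h' \<le> h" "0 \<le> \<alpha>"
  shows "semilocal b h' \<alpha> \<beta> p"
  unfolding semilocal_def
proof
  fix y
  have "measure_pmf.expectation (law b) (\<lambda>x. max (\<alpha> * W_star b h' x) y)
      \<le> measure_pmf.expectation (law b) (\<lambda>x. max (\<alpha> * W_star b h x) y)"
    using assms(3,4)
    by (intro integral_mono integrable_law assms(1) max.mono mult_left_mono)
      (auto simp: W_star_def)
  then show "(1 - p) * measure_pmf.expectation (law b) (\<lambda>x. max (W_open b x) y) + p * max (mean b) y
        \<ge> measure_pmf.expectation (law b) (\<lambda>x. max (\<alpha> * W_star b h' x) y) - p * \<beta> * mean b"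
    using assms(2)[unfolded semilocal_def, rule_format, of y] by linarith
qed

text \<open>For \<open>y\<close> up to the mean, every value of \<open>W_star\<close> is at least
  the mean, so dropping the factor \<open>\<alpha>\<close> saves at least
  \<open>(\<alpha> - 1) * mean b\<close>, which offsets that part of the loss.\<close>

lemma semilocal_rescale:
  assumes b: "wf_box b" and p: "0 \<le> p" "p \<le> 1" and \<alpha>: "1 \<le> \<alpha>"
    and sl: "semilocal b (mean b) \<alpha> \<beta> p"
  shows "semilocal b (mean b) 1 (\<beta> - (\<alpha> - 1)) p"
proof -
  define R where "R = (\<lambda>y. measure_pmf.expectation (law b) (\<lambda>x. max (W_open b x) y))"
  define S where "S = (\<lambda>y. measure_pmf.expectation (law b) (\<lambda>x. max (W_star b (mean b) x) y))"
  note int = integrable_law[OF b]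
  note mono = integral_mono[OF int int]
  have low: "(1 - p) * R y + p * max (mean b) y \<ge> S y - p * (\<beta> - (\<alpha> - 1)) * mean b"
    if "y \<le> mean b" for y
  proof -
    have "S y + (\<alpha> - 1) * mean b
        = measure_pmf.expectation (law b) (\<lambda>x. max (W_star b (mean b) x) y + (\<alpha> - 1) * mean b)"
      by (simp add: S_def int)
    also have "\<dots> \<le> measure_pmf.expectation (law b) (\<lambda>x. max (\<alpha> * W_star b (mean b) x) y)"
    proof (rule mono)
      fix x
      have W: "mean b \<le> W_star b (mean b) x" by (simp add: W_star_def)
      with \<alpha> have "(\<alpha> - 1) * mean b \<le> (\<alpha> - 1) * W_star b (mean b) x"
        by (intro mult_left_mono) auto
      with W that show "max (W_star b (mean b) x) y + (\<alpha> - 1) * mean b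
          \<le> max (\<alpha> * W_star b (mean b) x) y"
        by (simp add: algebra_simps max_def)
    qed
    finally have "S y + (\<alpha> - 1) * mean b - p * \<beta> * mean b \<le> (1 - p) * R y + p * max (mean b) y"
      using sl[unfolded semilocal_def, rule_format, of y] by (simp add: R_def)
    moreover have "p * ((\<alpha> - 1) * mean b) \<le> (\<alpha> - 1) * mean b"
      using p \<alpha> mean_nonneg[OF b] by (intro mult_left_le_one_le) auto
    ultimately show ?thesis by (simp add: algebra_simps)
  qed
  have high: "S y = R y" if "mean b \<le> y" for y
    unfolding S_def R_def using that
    by (intro Bochner_Integration.integral_cong) (auto simp: W_star_def)
  have "(1 - p) * R y + p * max (mean b) y \<ge> S y - p * (\<beta> - (\<alpha> - 1)) * mean b" for y
  proof (cases "y \<le> mean b")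
    case False
    \<comment> \<open>Beyond the mean the claim is a bound on \<open>p * (R y - y)\<close>. As
      \<open>R y - y\<close> is antitone, the instance at the mean suffices.\<close>
    have "R y \<le> measure_pmf.expectation (law b) (\<lambda>x. max (W_open b x) (mean b) + (y - mean b))"
      unfolding R_def using False by (intro mono) auto
    also have "\<dots> = R (mean b) + (y - mean b)" by (simp add: R_def int)
    finally have "p * (R y - y) \<le> p * (R (mean b) - mean b)"
      using p by (intro mult_left_mono) auto
    with low[of "mean b"] high[of y] high[of "mean b"] False show ?thesis
      by (simp add: algebra_simps)
  qed (rule low)
  then show ?thesis by (simp add: semilocal_def R_def S_def)
qed

text \<open>Take the threshold 0: the scaled \<open>W_star\<close> is worth at least
  \<open>\<alpha> * mean b\<close>, while neither opening nor grabbing is worth more than the mean.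
  This makes the loss left by \<open>semilocal_rescale\<close> nonnegative.\<close>

lemma semilocal_loss_ge:
  assumes b: "wf_box b" and p: "p \<in> {0..1}" and sl: "semilocal b (mean b) \<alpha> \<beta> p"
    and "0 \<le> \<alpha>" "0 \<le> \<beta>" "0 < mean b"
  shows "\<alpha> - 1 \<le> \<beta>"
proof -
  note int = integrable_law[OF b]
  have "measure_pmf.expectation (law b) (\<lambda>_. \<alpha> * mean b)
      \<le> measure_pmf.expectation (law b) (\<lambda>x. max (\<alpha> * W_star b (mean b) x) 0)"
    using assms(4) by (intro integral_mono int) (auto simp: W_star_def max.coboundedI1 mult_left_mono)
  moreover have "measure_pmf.expectation (law b) (\<lambda>x. max (W_open b x) 0)
      \<le> measure_pmf.expectation (law b) (\<lambda>x. x)"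
    using b by (intro integral_mono_AE int) (auto simp: AE_measure_pmf_iff wf_box_def W_open_def)
  then have "(1 - p) * measure_pmf.expectation (law b) (\<lambda>x. max (W_open b x) 0)
      \<le> (1 - p) * mean b"
    using p by (intro mult_left_mono) (auto simp: mean_def)
  moreover have "p * \<beta> * mean b \<le> \<beta> * mean b"
    using p assms(5,6) by (intro mult_right_mono mult_left_le_one_le) auto
  ultimately have "\<alpha> * mean b \<le> (1 + \<beta>) * mean b"
    using sl[unfolded semilocal_def, rule_format, of 0] assms(6) by (simp add: algebra_simps)
  with assms(6) show ?thesis by simp
qed

section \<open>Heaviest extensions in a matroid\<close>

text \<open>Weight still obtainable once \<open>A\<close> is accepted. All independent supersets
  compete, not only bases, so negative weights can be declined.\<close>

definition best :: "'a set set \<Rightarrow> 'a set \<Rightarrow> ('a \<Rightarrow> real) \<Rightarrow> real" where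
  "best F A w = Max ((\<lambda>S. sum w (S - A)) ` {S\<in>F. A \<subseteq> S})"

lemma matroid_finite:
  assumes "matroid E F"
  shows "finite F" and "S \<in> F \<Longrightarrow> finite S"
  using assms by (auto simp: matroid_def intro: finite_subset)

lemma matroid_subset: "matroid E F \<Longrightarrow> S \<in> F \<Longrightarrow> T \<subseteq> S \<Longrightarrow> T \<in> F"
  by (auto simp: matroid_def)

lemma best_upper: "finite F \<Longrightarrow> S \<in> F \<Longrightarrow> A \<subseteq> S \<Longrightarrow> sum w (S - A) \<le> best F A w"
  unfolding best_def by (intro Max_ge) auto

lemma best_attained:
  assumes "finite F" "A \<in> F"
  obtains S where "S \<in> F" "A \<subseteq> S" "best F A w = sum w (S - A)"
proof -
  have "best F A w \<in> (\<lambda>S. sum w (S - A)) ` {S\<in>F. A \<subseteq> S}"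
    unfolding best_def using assms by (intro Max_in) auto
  then show thesis using that by auto
qed

lemma best_nonneg: "finite F \<Longrightarrow> A \<in> F \<Longrightarrow> 0 \<le> best F A w"
  using best_upper[of F A A w] by simp

lemma best_cong:
  "(\<And>S i. S \<in> F \<Longrightarrow> A \<subseteq> S \<Longrightarrow> i \<in> S - A \<Longrightarrow> w i = w' i) \<Longrightarrow> best F A w = best F A w'"
  unfolding best_def by (intro arg_cong[where f = Max] image_cong sum.cong) auto

lemma best_insert_le:
  assumes "matroid E F" "insert i A \<in> F" "i \<notin> A"
  shows "w i + best F (insert i A) w \<le> best F A w"
proof -
  note fin = matroid_finite[OF assms(1)]
  obtain S where S: "S \<in> F" "insert i A \<subseteq> S" "best F (insert i A) w = sum w (S - insert i A)"
    using best_attained[OF fin(1) assms(2)] .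
  have "sum w (S - A) = w i + sum w (S - A - {i})"
    using S fin(2) assms(3) by (intro sum.remove) auto
  also have "S - A - {i} = S - insert i A" by auto
  finally show ?thesis using best_upper[OF fin(1) S(1), of A w] S by simp
qed

lemma best_scale:
  assumes "finite F" "A \<in> F" "0 \<le> \<alpha>"
  shows "\<alpha> * best F A w = best F A (\<lambda>i. \<alpha> * w i)"
proof -
  have "\<alpha> * best F A w = Max ((*) \<alpha> ` (\<lambda>S. sum w (S - A)) ` {S\<in>F. A \<subseteq> S})"
    unfolding best_def using assms
    by (intro mono_Max_commute) (auto simp: mono_def mult_left_mono)
  then show ?thesis by (simp add: best_def image_image sum_distrib_left)
qed

text \<open>Extensions avoiding \<open>i\<close> contribute a constant, those using \<open>i\<close>
  contribute \<open>x\<close> plus a constant. This reduces a comparison of laws at one box to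
  thresholds \<open>y\<close>, the form in which semilocality is stated.\<close>

lemma best_update_cases:
  assumes M: "matroid E F" and A: "A \<in> F" "i \<notin> A"
  obtains (const) c where "insert i A \<notin> F" "\<And>x. best F A (w(i := x)) = c"
    | (max) c y where "insert i A \<in> F" "\<And>x. best F A (w(i := x)) = c + max x y"
proof (cases "insert i A \<in> F")
  case False
  have "best F A (w(i := x)) = best F A w" for x
  proof (rule best_cong)
    fix S j assume S: "S \<in> F" "A \<subseteq> S" "j \<in> S - A"
    with False matroid_subset[OF M S(1), of "insert i A"] have "i \<notin> S" by auto
    with S show "(w(i := x)) j = w j" by auto
  qed
  with False show ?thesis by (rule const)
next
  case True
  note fin = matroid_finite[OF M]
  \<comment> \<open>Deleting \<open>i\<close> gives \<open>F'\<close>, contracting it gives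
    \<open>c\<close>; the threshold is the difference of the two optima.\<close>
  define F' where "F' = {S\<in>F. i \<notin> S}"
  define c where "c = best F (insert i A) w"
  have F': "finite F'" "A \<in> F'" using fin A by (auto simp: F'_def)
  have "best F A (w(i := x)) = c + max x (best F' A w - c)" for x
  proof (rule antisym)
    obtain S where S: "S \<in> F" "A \<subseteq> S" "best F A (w(i := x)) = sum (w(i := x)) (S - A)"
      using best_attained[OF fin(1) A(1)] .
    show "best F A (w(i := x)) \<le> c + max x (best F' A w - c)"
    proof (cases "i \<in> S")
      case True
      have "sum (w(i := x)) (S - A) = x + sum (w(i := x)) (S - A - {i})"
        using S fin(2) A True by (subst sum.remove[of _ i]) auto
      also have "sum (w(i := x)) (S - A - {i}) = sum w (S - insert i A)"
        by (intro sum.cong) auto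
      also have "\<dots> \<le> c"
        unfolding c_def using S True fin by (intro best_upper) auto
      finally show ?thesis using S by simp
    next
      case False
      have "sum (w(i := x)) (S - A) = sum w (S - A)"
        using False by (intro sum.cong) auto
      also have "\<dots> \<le> best F' A w"
        using S False F' by (intro best_upper) (auto simp: F'_def)
      finally show ?thesis using S by simp
    qed
  next
    have "x + c \<le> best F A (w(i := x))"
      using best_insert_le[OF M True A(2), of "w(i := x)"]
        best_cong[of F "insert i A" "w(i := x)" w] by (simp add: c_def)
    moreover obtain S where S: "S \<in> F'" "A \<subseteq> S" "best F' A w = sum w (S - A)"
      using best_attained[OF F'] .
    have "sum w (S - A) = sum (w(i := x)) (S - A)"
      using S by (intro sum.cong) (auto simp: F'_def)
    then have "best F' A w \<le> best F A (w(i := x))"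
      using best_upper[OF fin(1), of S A "w(i := x)"] S by (simp add: F'_def)
    ultimately show "c + max x (best F' A w - c) \<le> best F A (w(i := x))" by simp
  qed
  with True show ?thesis by (rule max)
qed

section \<open>Exchange arguments\<close>

lemma matroid_extend:
  assumes M: "matroid E F" and IS: "I \<in> F" "S \<in> F" "card I \<le> card S"
  obtains J where "J \<in> F" "I \<subseteq> J" "J \<subseteq> I \<union> S" "card J = card S"
  using IS
proof (induction "card S - card I" arbitrary: I thesis)
  case 0
  then show ?case by (metis diff_is_0_eq le_antisym sup_ge1 order_refl)
next
  case (Suc n)
  then have "card I < card S" by simp
  with Suc M obtain t where t: "t \<in> S - I" "insert t I \<in> F" unfolding matroid_def by metis
  have c: "card (insert t I) = Suc (card I)"
    using t matroid_finite(2)[OF M \<open>I \<in> F\<close>] by simp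
  obtain J where "J \<in> F" "insert t I \<subseteq> J" "J \<subseteq> insert t I \<union> S" "card J = card S"
    by (rule Suc.hyps(1)[of "insert t I"]) (use Suc t c in auto)
  with t show ?case by (intro Suc.prems(1)[of J]) auto
qed

text \<open>Suppose an optimal set avoids \<open>i\<close>. Extending \<open>insert i A\<close> from
  it to the same size drops only one of its elements, and that element is itself a candidate for
  extending \<open>A\<close>, hence no heavier than \<open>i\<close>.\<close>

lemma best_greedy:
  assumes M: "matroid E F" and A: "insert i A \<in> F" "i \<notin> A" and "0 \<le> w i"
    and heaviest: "\<And>j. j \<notin> A \<Longrightarrow> insert j A \<in> F \<Longrightarrow> w j \<le> w i"
  shows "best F A w = w i + best F (insert i A) w"
proof (rule antisym)
  note fin = matroid_finite[OF M]
  obtain S where S: "S \<in> F" "A \<subseteq> S" "best F A w = sum w (S - A)"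
    using best_attained[OF fin(1) matroid_subset[OF M A(1)], of A w] by auto
  have "sum w (S - A) \<le> w i + best F (insert i A) w"
  proof (cases "i \<in> S \<or> A = S")
    case True
    then show ?thesis
    proof
      assume i: "i \<in> S"
      then have "sum w (S - A) = w i + sum w (S - A - {i})"
        using S fin(2) A by (intro sum.remove) auto
      also have "S - A - {i} = S - insert i A" by auto
      finally show ?thesis using best_upper[OF fin(1) S(1), of "insert i A" w] S i by simp
    next
      assume "A = S"
      then show ?thesis using \<open>0 \<le> w i\<close> best_nonneg[OF fin(1) A(1), of w] by simp
    qed
  next
    case False
    have fS: "finite S" "finite A" using fin(2) S finite_subset by auto
    have "card A < card S" using False S fS by (intro psubset_card_mono) auto
    then have "card (insert i A) \<le> card S" using A fS by simp
    then obtain J where J: "J \<in> F" "insert i A \<subseteq> J" "J \<subseteq> insert i A \<union> S" "card J = card S"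
      using matroid_extend[OF M A(1) S(1)] by metis
    have "J \<subseteq> insert i S" using J S by auto
    \<comment> \<open>\<open>insert i S\<close> has one element more than \<open>J\<close>, so
      exactly one \<open>t\<close> is traded for \<open>i\<close>.\<close>
    moreover have "card (insert i S - J) = 1"
      using fS False J \<open>J \<subseteq> insert i S\<close> finite_subset[OF \<open>J \<subseteq> insert i S\<close>]
      by (subst card_Diff_subset) auto
    then obtain t where t: "insert i S - J = {t}" using card_1_singletonE by metis
    ultimately have tS: "t \<in> S - A" "J - insert i A = S - A - {t}"
      using J S False A by auto
    have "w t \<le> w i"
      using tS S matroid_subset[OF M S(1), of "insert t A"] by (intro heaviest) auto
    moreover have "sum w (S - A) = w t + sum w (S - A - {t})"
      using tS fS by (intro sum.remove) auto
    moreover have "sum w (J - insert i A) \<le> best F (insert i A) w"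
      using J fin by (intro best_upper) auto
    ultimately show ?thesis using tS by simp
  qed
  with S show "best F A w \<le> w i + best F (insert i A) w" by simp
qed (rule best_insert_le[OF M A])

text \<open>An optimal set using \<open>i\<close> can trade it for an element of \<open>G\<close>
  weighing at least \<open>m\<close>. The new set avoids \<open>i\<close>, so its weight is the same
  for every \<open>x\<close>.\<close>

lemma best_spanned_le:
  assumes M: "matroid E F" and G: "G \<in> F" "insert i G \<notin> F" and m: "\<And>j. j \<in> G \<Longrightarrow> m \<le> w j"
  shows "best F {} (w(i := m)) \<le> best F {} (w(i := x))"
proof -
  note fin = matroid_finite[OF M]
  have iG: "i \<notin> G" using G by (auto simp: insert_absorb)
  obtain S where S: "S \<in> F" "best F {} (w(i := m)) = sum (w(i := m)) S"
    using best_attained[of F "{}" "w(i := m)"] fin M by (auto simp: matroid_def)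
  show ?thesis
  proof (cases "i \<in> S")
    case False
    then have "sum (w(i := m)) S = sum (w(i := x)) S" by (intro sum.cong) auto
    with best_upper[OF fin(1) S(1), of "{}" "w(i := x)"] S show ?thesis by simp
  next
    case True
    \<comment> \<open>\<open>J\<close> contains \<open>G\<close>, hence not \<open>i\<close>.
      Augmenting \<open>S - {i}\<close> from \<open>J\<close> therefore adds an element outside
      \<open>S\<close>, which must lie in \<open>G\<close>.\<close>
    obtain J where J: "J \<in> F" "G \<subseteq> J" "J \<subseteq> G \<union> S" "card S \<le> card J"
    proof (cases "card G \<le> card S")
      case True
      then show ?thesis using matroid_extend[OF M G(1) S(1)] that by (metis order_refl)
    qed (use that[of G] G in auto)
    have iJ: "i \<notin> J" using matroid_subset[OF M J(1), of "insert i G"] G J by auto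
    have "card (S - {i}) < card J"
      using True fin(2)[OF S(1)] J by (intro less_le_trans[OF card_Diff1_less]) auto
    moreover have S1: "S - {i} \<in> F" using matroid_subset[OF M S(1)] by auto
    ultimately obtain t where t: "t \<in> J - (S - {i})" "insert t (S - {i}) \<in> F"
      using M J(1) unfolding matroid_def by metis
    have t': "t \<in> G" "t \<notin> S" using t iJ J by auto
    have "sum (w(i := m)) S = m + sum w (S - {i})"
      using True fin(2)[OF S(1)] by (subst sum.remove[of _ i]) (auto intro!: sum.cong)
    also have "\<dots> \<le> w t + sum w (S - {i})" using m t' by simp
    also have "\<dots> = sum (w(i := x)) (insert t (S - {i}))"
      using t' iG fin(2)[OF S(1)] by (subst sum.insert) (auto intro!: sum.cong)
    also have "\<dots> \<le> best F {} (w(i := x))"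
      using best_upper[OF fin(1) t(2), of "{}" "w(i := x)"] by simp
    finally show ?thesis using S by simp
  qed
qed

section \<open>Averages over independent weights\<close>

text \<open>Only the coordinates in \<open>U\<close> are random. Those outside are already settled
  by \<open>v\<close>, which overwrites the default 0 of \<open>Pi_pmf\<close>.\<close>

definition avg ::
  "'a set \<Rightarrow> ('a \<Rightarrow> real) \<Rightarrow> ('a \<Rightarrow> real pmf) \<Rightarrow> (('a \<Rightarrow> real) \<Rightarrow> real) \<Rightarrow> real" where
  "avg U v D \<phi> = measure_pmf.expectation (Pi_pmf U 0 D) (\<lambda>u. \<phi> (override_on v u U))"

section \<open>Expectations over finite supports\<close>

lemma finite_support_Pi_pmf:
  assumes "finite U" "\<forall>j\<in>U. finite (set_pmf (D j))"
  shows "finite (set_pmf (Pi_pmf U d D))"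
  unfolding set_Pi_pmf[OF assms(1)] using assms by (intro finite_PiE_dflt) auto

lemma expectation_bind_finite:
  fixes \<phi> :: "'b \<Rightarrow> real"
  assumes "finite (set_pmf p)" "\<And>x. x \<in> set_pmf p \<Longrightarrow> finite (set_pmf (f x))"
  shows "measure_pmf.expectation (p \<bind> f) \<phi>
      = measure_pmf.expectation p (\<lambda>x. measure_pmf.expectation (f x) \<phi>)"
  using assms by (subst pmf_expectation_bind[of "set_pmf p"]) (auto simp: integral_measure_pmf[of "set_pmf p"])

lemma expectation_swap_finite:
  fixes \<phi> :: "'a \<Rightarrow> 'b \<Rightarrow> real"
  assumes "finite (set_pmf p)" "finite (set_pmf q)"
  shows "measure_pmf.expectation p (\<lambda>x. measure_pmf.expectation q (\<phi> x))
      = measure_pmf.expectation q (\<lambda>y. measure_pmf.expectation p (\<lambda>x. \<phi> x y))"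
  using assms
  by (simp add: integral_measure_pmf[of "set_pmf p"] integral_measure_pmf[of "set_pmf q"]
      sum_distrib_left mult.left_commute sum.swap[of _ "set_pmf p"])

lemma expectation_mono_finite:
  fixes f g :: "'a \<Rightarrow> real"
  assumes "finite (set_pmf p)" "\<And>x. x \<in> set_pmf p \<Longrightarrow> f x \<le> g x"
  shows "measure_pmf.expectation p f \<le> measure_pmf.expectation p g"
  using assms by (intro integral_mono_AE) (auto simp: AE_measure_pmf_iff integrable_measure_pmf_finite)

context
  fixes U :: "'a set" and D :: "'a \<Rightarrow> real pmf"
  assumes fin: "finite U" "\<forall>j\<in>U. finite (set_pmf (D j))"
begin

lemma integrable_avg: "integrable (measure_pmf (Pi_pmf U d D)) (\<phi> :: ('a \<Rightarrow> real) \<Rightarrow> real)"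
  by (intro integrable_measure_pmf_finite finite_support_Pi_pmf fin)

lemma avg_mono:
  assumes "\<And>w. (\<And>j. j \<notin> U \<Longrightarrow> w j = v j) \<Longrightarrow> (\<And>j. j \<in> U \<Longrightarrow> w j \<in> set_pmf (D j)) \<Longrightarrow> \<phi> w \<le> \<psi> w"
  shows "avg U v D \<phi> \<le> avg U v D \<psi>"
  unfolding avg_def
proof (rule expectation_mono_finite[OF finite_support_Pi_pmf[OF fin]])
  fix u assume "u \<in> set_pmf (Pi_pmf U 0 D)"
  then have "\<And>j. j \<in> U \<Longrightarrow> u j \<in> set_pmf (D j)"
    using set_Pi_pmf[OF fin(1), of 0 D] by (auto simp: PiE_dflt_def)
  then show "\<phi> (override_on v u U) \<le> \<psi> (override_on v u U)"
    by (intro assms) auto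
qed

lemma avg_add: "avg U v D (\<lambda>w. \<phi> w + \<psi> w) = avg U v D \<phi> + avg U v D \<psi>"
  by (simp add: avg_def integrable_avg)

lemma avg_cmult: "avg U v D (\<lambda>w. c * \<phi> w) = c * avg U v D \<phi>"
  by (simp add: avg_def)

lemma avg_const [simp]: "avg U v D (\<lambda>_. c) = c"
  by (simp add: avg_def)

lemma expectation_avg:
  assumes "i \<notin> U" "finite (set_pmf d)"
  shows "measure_pmf.expectation d (\<lambda>x. avg U (v(i := x)) D \<phi>)
      = avg U v D (\<lambda>w. measure_pmf.expectation d (\<lambda>x. \<phi> (w(i := x))))"
proof -
  have "override_on (v(i := x)) u U = (override_on v u U)(i := x)" for x u
    using assms(1) by (auto simp: override_on_def)
  then show ?thesis
    unfolding avg_def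
    by (subst expectation_swap_finite) (simp_all add: assms finite_support_Pi_pmf fin)
qed

lemma avg_insert:
  assumes "i \<notin> U" "finite (set_pmf (D i))"
  shows "avg (insert i U) v D \<phi>
      = avg U v D (\<lambda>w. measure_pmf.expectation (D i) (\<lambda>x. \<phi> (w(i := x))))"
proof -
  have "avg (insert i U) v D \<phi> = measure_pmf.expectation (D i) (\<lambda>x. avg U (v(i := x)) D \<phi>)"
    unfolding avg_def Pi_pmf_insert'[OF fin(1) assms(1)]
    using assms fin
    by (simp add: expectation_bind_finite finite_support_Pi_pmf map_pmf_def[symmetric])
      (intro Bochner_Integration.integral_cong refl arg_cong[where f = \<phi>],
       auto simp: override_on_def)
  then show ?thesis by (simp add: expectation_avg assms)
qed

end

lemma avg_cong:
  assumes "\<And>j. j \<in> U \<Longrightarrow> D j = D' j"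
  shows "avg U v D \<phi> = avg U v D' \<phi>"
  unfolding avg_def using Pi_pmf_cong[of U U 0 0 D D'] assms by simp

text \<open>The coordinates outside \<open>U\<close> are fixed at 0; \<open>f 0 = 0\<close> makes
  both sides agree there.\<close>

lemma avg_map:
  assumes "finite U" and "f 0 = (0 :: real)"
  shows "avg U (\<lambda>_. 0) (\<lambda>j. map_pmf f (D j)) \<phi> = avg U (\<lambda>_. 0) D (\<lambda>w. \<phi> (\<lambda>j. f (w j)))"
proof -
  have "override_on (\<lambda>_. 0) (f \<circ> u) U = (\<lambda>j. f (override_on (\<lambda>_. 0) u U j))" for u
    using assms(2) by (auto simp: override_on_def)
  then show ?thesis
    by (simp add: avg_def Pi_pmf_map[OF assms(1), of f 0 0] assms(2))
qed

section \<open>An upper bound on the optimum\<close>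

text \<open>The floor is \<open>h'_index\<close>, for which \<open>W_star\<close> keeps the mean;
  larger floors are brought down to it by \<open>semilocal_antimono\<close>.\<close>

definition star_law :: "box \<Rightarrow> real pmf" where
  "star_law b = map_pmf (W_star b (h'_index b)) (law b)"

lemma finite_star_law: "wf_box b \<Longrightarrow> finite (set_pmf (star_law b))"
  by (simp add: star_law_def wf_box_def)

lemma finite_outcome: "wf_box b \<Longrightarrow> finite (set_pmf (outcome b a))"
  by (cases a) (simp_all add: wf_box_def)

text \<open>If \<open>i\<close> cannot be added to \<open>A\<close>, advancing it only costs;
  otherwise the single-box bounds apply at the threshold supplied by
  \<open>best_update_cases\<close>.\<close>

lemma outcome_le_star_law:
  assumes M: "matroid E F" and A: "A \<in> F" "i \<notin> A" and b: "wf_box b" "normalized b"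
  shows "measure_pmf.expectation (outcome b a) (\<lambda>x. best F A (w(i := x))) - action_cost b a
      \<le> measure_pmf.expectation (star_law b) (\<lambda>x. best F A (w(i := x)))"
proof (cases rule: best_update_cases[OF M A, of w])
  case (1 c)
  then show ?thesis using b(1) by (cases a) (auto simp: wf_box_def)
next
  case (2 c y)
  note int = integrable_measure_pmf_finite[OF finite_outcome[OF b(1)]]
  show ?thesis
    using open_le_W_star[OF b, of y] grab_le_W_star[OF b, of y]
    by (cases a) (simp_all add: 2 star_law_def integrable_law[OF b(1)])
qed

text \<open>The expected \<open>best\<close> serves as a potential: boxes not yet advanced carry
  their \<open>W_star\<close> surrogates, advanced ones their true values. No move increases
  collected utility plus potential in expectation.\<close>

lemma utility_le_avg_best:
  assumes M: "matroid E F" and b: "\<And>i. i \<in> E \<Longrightarrow> wf_box (B i) \<and> normalized (B i)"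
  shows "feasible E F C \<pi> T A \<Longrightarrow> T \<subseteq> E \<Longrightarrow> A \<subseteq> T \<Longrightarrow> A \<in> F \<Longrightarrow>
    utility B \<pi> v \<le> avg (E - T) v (\<lambda>i. star_law (B i)) (best F A)"
proof (induction \<pi> arbitrary: T A v)
  have fE: "finite E" using M by (simp add: matroid_def)
  have fs: "\<forall>j\<in>E - T. finite (set_pmf (star_law (B j)))" for T
    using b finite_star_law by auto
  note fU = finite_Diff[OF fE] fs
  note finF = matroid_finite(1)[OF M]
  {
    case Stop
    have "avg (E - T) v (\<lambda>i. star_law (B i)) (\<lambda>_. 0)
        \<le> avg (E - T) v (\<lambda>i. star_law (B i)) (best F A)"
      using best_nonneg[OF finF Stop.prems(4)] by (intro avg_mono fU)
    then show ?case by (simp add: avg_const[OF fU])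
  next
    case (Accept i k)
    then have i: "i \<in> T" "i \<notin> A" "insert i A \<in> F" by auto
    have "utility B k v \<le> avg (E - T) v (\<lambda>i. star_law (B i)) (best F (insert i A))"
      using Accept by (intro Accept.IH) auto
    then have "utility B (Accept i k) v
        \<le> avg (E - T) v (\<lambda>i. star_law (B i)) (\<lambda>w. v i + best F (insert i A) w)"
      by (simp add: avg_add[OF fU] avg_const[OF fU])
    also have "\<dots> \<le> avg (E - T) v (\<lambda>i. star_law (B i)) (best F A)"
    proof (rule avg_mono[OF fU])
      fix w assume "\<And>j. j \<notin> E - T \<Longrightarrow> w j = v j"
      with i have "w i = v i" by auto
      then show "v i + best F (insert i A) w \<le> best F A w"
        using best_insert_le[OF M i(3,2), of w] by simp
    qed
    finally show ?case .
  next
    case (Advance i q k)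
    then have i: "i \<in> E" "i \<notin> T" "i \<notin> A" by auto
    have U: "E - T = insert i (E - insert i T)" "i \<notin> E - insert i T" using i by auto
    have "finite (set_pmf q)"
      by (rule finite_subset[of _ "{Open, Grab}"]) (use action.exhaust in auto)
    moreover have "measure_pmf.expectation (outcome (B i) a)
        (\<lambda>x. utility B (k a x) (v(i := x))) - action_cost (B i) a
      \<le> avg (E - T) v (\<lambda>i. star_law (B i)) (best F A)" for a
    proof -
      have fo: "finite (set_pmf (outcome (B i) a))" using b i finite_outcome by auto
      have "measure_pmf.expectation (outcome (B i) a) (\<lambda>x. utility B (k a x) (v(i := x)))
        \<le> measure_pmf.expectation (outcome (B i) a)
            (\<lambda>x. avg (E - insert i T) (v(i := x)) (\<lambda>i. star_law (B i)) (best F A))"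
        using Advance.prems by (intro expectation_mono_finite[OF fo] Advance.IH) auto
      \<comment> \<open>Exchanging the expectations fixes all other weights, so that a single box
        can be compared with its surrogate.\<close>
      also have "\<dots> = avg (E - insert i T) v (\<lambda>i. star_law (B i))
          (\<lambda>w. measure_pmf.expectation (outcome (B i) a) (\<lambda>x. best F A (w(i := x))))"
        by (intro expectation_avg fU fo U)
      also have "\<dots> \<le> avg (E - insert i T) v (\<lambda>i. star_law (B i))
          (\<lambda>w. measure_pmf.expectation (star_law (B i)) (\<lambda>x. best F A (w(i := x)))
             + action_cost (B i) a)"
        using outcome_le_star_law[OF M Advance.prems(4) i(3), of "B i" a] b[OF i(1)]
        by (intro avg_mono fU) (simp_all add: diff_le_eq)
      also have "\<dots> = avg (E - T) v (\<lambda>i. star_law (B i)) (best F A) + action_cost (B i) a"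
        unfolding U(1) using i
        by (subst avg_insert[OF fU U(2)]) (simp_all add: avg_add[OF fU] avg_const[OF fU] fs[of "{}", simplified])
      finally show ?thesis by simp
    qed
    ultimately show ?case by (simp add: expectation_le_const)
  }
qed

section \<open>The index policy for a fixed commitment\<close>

text \<open>Weitzman's index rule: among the elements that can still be accepted, take one of
  largest key, and stop when no key is positive. A box found above its index is accepted next, so
  the overshoot \<open>max (x - g i) 0\<close> is always collected and pays for the cost in
  expectation.\<close>

lemma exists_index_policy:
  assumes M: "matroid E F"
    and fo: "\<And>i. i \<in> E \<Longrightarrow> finite (set_pmf (outcome (B i) (a i)))"
    and g: "\<And>i. i \<in> E \<Longrightarrow> action_cost (B i) (a i)
      = measure_pmf.expectation (outcome (B i) (a i)) (\<lambda>x. max (x - g i) 0)"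
  shows "T \<subseteq> E \<Longrightarrow> A \<subseteq> T \<Longrightarrow> A \<in> F \<Longrightarrow>
    \<exists>\<pi>. feasible E F (\<lambda>i. {return_pmf (a i)}) \<pi> T A \<and>
      avg (E - T) v (\<lambda>i. map_pmf (\<lambda>x. min x (g i)) (outcome (B i) (a i))) (best F A)
        \<le> utility B \<pi> v"
proof (induction "card (E - T) + card (E - A)" arbitrary: T A v rule: less_induct)
  case less
  define D where "D = (\<lambda>i. map_pmf (\<lambda>x. min x (g i)) (outcome (B i) (a i)))"
  \<comment> \<open>An upper bound on the weight \<open>j\<close> can still receive: its value if
    known, otherwise the cap \<open>g j\<close>.\<close>
  define key where "key j = (if j \<in> T then v j else g j)" for j
  define K where "K = {j \<in> E - A. insert j A \<in> F}"
  have fE: "finite E" using M by (simp add: matroid_def)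
  have fD: "\<forall>j\<in>E - T. finite (set_pmf (D j))" for T using fo by (simp add: D_def)
  note fU = finite_Diff[OF fE] fD
  note finF = matroid_finite(1)[OF M]
  have inK: "j \<in> K" if "j \<notin> A" "insert j A \<in> F" for j
    using that M by (auto simp: K_def matroid_def)
  have w_le_key: "w j \<le> key j"
    if "j \<in> K" "\<And>j. j \<notin> E - T \<Longrightarrow> w j = v j" "\<And>j. j \<in> E - T \<Longrightarrow> w j \<in> set_pmf (D j)" for j w
  proof (cases "j \<in> T")
    case False
    with that(1) that(3)[of j] show ?thesis by (auto simp: K_def key_def D_def)
  qed (use that(2)[of j] in \<open>auto simp: key_def\<close>)
  have fK: "finite K" using fE by (simp add: K_def)
  show ?case
  proof (cases "\<exists>j\<in>K. 0 < key j")
    case False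
    \<comment> \<open>No remaining weight can be positive, so stopping, which is worth 0, matches
      the bound.\<close>
    have "avg (E - T) v D (best F A) \<le> avg (E - T) v D (\<lambda>_. 0)"
    proof (rule avg_mono[OF fU])
      fix w assume w: "\<And>j. j \<notin> E - T \<Longrightarrow> w j = v j" "\<And>j. j \<in> E - T \<Longrightarrow> w j \<in> set_pmf (D j)"
      obtain S where S: "S \<in> F" "A \<subseteq> S" "best F A w = sum w (S - A)"
        using best_attained[OF finF less.prems(3)] .
      have "w j \<le> 0" if "j \<in> S - A" for j
      proof -
        have "j \<in> K" using that S matroid_subset[OF M S(1), of "insert j A"] by (intro inK) auto
        with w_le_key[OF this w] False show ?thesis by auto
      qed
      then have "sum w (S - A) \<le> 0" by (rule sum_nonpos)
      with S show "best F A w \<le> 0" by simp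
    qed
    then show ?thesis
      by (intro exI[of _ Stop]) (simp add: avg_const[OF fU] D_def[symmetric])
  next
    case True
    then have "K \<noteq> {}" by auto
    with fK obtain i where i: "i \<in> K" "\<And>j. j \<in> K \<Longrightarrow> key j \<le> key i"
      using arg_min_if_finite[of K "\<lambda>j. - key j"] by (metis linorder_not_le neg_less_iff_less)
    with True have pos: "0 < key i" by force
    have iE: "i \<in> E" "i \<notin> A" "insert i A \<in> F" using i by (auto simp: K_def)
    show ?thesis
    proof (cases "i \<in> T")
      case True
      \<comment> \<open>The known value of \<open>i\<close> dominates all keys, so accepting it
        greedily loses nothing.\<close>
      have "card (E - insert i A) < card (E - A)"
        using fE iE by (intro psubset_card_mono) auto
      then have "\<exists>\<pi>. feasible E F (\<lambda>i. {return_pmf (a i)}) \<pi> T (insert i A) \<and>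
          avg (E - T) v D (best F (insert i A)) \<le> utility B \<pi> v"
        unfolding D_def using less.prems iE True by (intro less.hyps) auto
      then obtain \<pi> where \<pi>: "feasible E F (\<lambda>i. {return_pmf (a i)}) \<pi> T (insert i A)"
        "avg (E - T) v D (best F (insert i A)) \<le> utility B \<pi> v" by blast
      have "avg (E - T) v D (best F A) \<le> avg (E - T) v D (\<lambda>w. v i + best F (insert i A) w)"
      proof (rule avg_mono[OF fU])
        fix w assume w: "\<And>j. j \<notin> E - T \<Longrightarrow> w j = v j" "\<And>j. j \<in> E - T \<Longrightarrow> w j \<in> set_pmf (D j)"
        have wi: "w i = v i" "v i = key i" using True w(1) by (auto simp: key_def)
        have "w j \<le> w i" if "j \<notin> A" "insert j A \<in> F" for j
          using w_le_key[OF inK[OF that] w] i(2)[OF inK[OF that]] wi by simp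
        with best_greedy[OF M iE(3,2), of w] wi pos
        show "best F A w \<le> v i + best F (insert i A) w" by simp
      qed
      with \<pi> show ?thesis
        using True iE by (intro exI[of _ "Accept i \<pi>"]) (simp add: avg_const[OF fU] avg_add[OF fU] D_def[symmetric])
    next
      case False
      have key: "key i = g i" using False by (simp add: key_def)
      define T' where "T' = insert i T"
      have U: "E - T = insert i (E - T')" "i \<notin> E - T'" using iE False by (auto simp: T'_def)
      have "card (E - T') < card (E - T)"
        using fE iE False by (intro psubset_card_mono) (auto simp: T'_def)
      \<comment> \<open>\<open>feasible\<close> demands a continuation for every real
        \<open>x\<close>, not just for those in the support.\<close>
      with less.hyps[of T' A] less.prems iE False
      have "\<forall>x. \<exists>\<pi>. feasible E F (\<lambda>i. {return_pmf (a i)}) \<pi> T' A \<and>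
          avg (E - T') (v(i := x)) D (best F A) \<le> utility B \<pi> (v(i := x))"
        by (auto simp: D_def T'_def)
      then obtain \<pi> where \<pi>: "\<And>x. feasible E F (\<lambda>i. {return_pmf (a i)}) (\<pi> x) T' A"
        "\<And>x. avg (E - T') (v(i := x)) D (best F A) \<le> utility B (\<pi> x) (v(i := x))"
        by metis
      let ?O = "measure_pmf.expectation (outcome (B i) (a i))"
      note fi = fo[OF iE(1)]
      note int = integrable_measure_pmf_finite[OF fi]
      have "avg (E - T) v D (best F A)
          = avg (E - T') v D (\<lambda>w. ?O (\<lambda>x. best F A (w(i := min x (g i)))))"
        unfolding U(1) using fi by (subst avg_insert[OF fU U(2)]) (simp_all add: D_def)
      also have "\<dots> \<le> avg (E - T') v D
          (\<lambda>w. ?O (\<lambda>x. best F A (w(i := x))) + (- action_cost (B i) (a i)))"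
      proof (rule avg_mono[OF fU])
        fix w assume w: "\<And>j. j \<notin> E - T' \<Longrightarrow> w j = v j" "\<And>j. j \<in> E - T' \<Longrightarrow> w j \<in> set_pmf (D j)"
        \<comment> \<open>At its cap \<open>i\<close> is already a heaviest candidate, so any
          overshoot adds to \<open>best\<close> in full.\<close>
        have "best F A (w(i := min x (g i))) \<le> best F A (w(i := x)) - max (x - g i) 0" for x
        proof (cases "x \<le> g i")
          case False
          have cong: "best F (insert i A) (w(i := z)) = best F (insert i A) w" for z
            by (rule best_cong) auto
          have le: "w j \<le> g i" if "j \<notin> A" "insert j A \<in> F" "j \<noteq> i" for j
          proof -
            have "w j \<le> key j"
            proof (cases "j \<in> T")
              case True
              with w(1)[of j] show ?thesis by (simp add: key_def T'_def)
            next
              case False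
              with w(2)[of j] inK[OF that(1,2)] that(3) show ?thesis
                by (auto simp: key_def T'_def D_def K_def)
            qed
            with i(2)[OF inK[OF that(1,2)]] key show ?thesis by simp
          qed
          have "best F A (w(i := g i)) = g i + best F (insert i A) w"
            using best_greedy[OF M iE(3,2), of "w(i := g i)"] le pos key cong by auto
          moreover have "x + best F (insert i A) w \<le> best F A (w(i := x))"
            using best_insert_le[OF M iE(3,2), of "w(i := x)"] cong by simp
          ultimately show ?thesis using False by (simp add: min_def)
        qed simp
        then have "?O (\<lambda>x. best F A (w(i := min x (g i))))
            \<le> ?O (\<lambda>x. best F A (w(i := x)) - max (x - g i) 0)"
          by (intro expectation_mono_finite fi)
        \<comment> \<open>The expected overshoot equals the cost by the equation for
          \<open>g\<close>.\<close>
        then show "?O (\<lambda>x. best F A (w(i := min x (g i))))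
            \<le> ?O (\<lambda>x. best F A (w(i := x))) + (- action_cost (B i) (a i))"
          by (simp add: int g[OF iE(1)])
      qed
      also have "\<dots> = ?O (\<lambda>x. avg (E - T') (v(i := x)) D (best F A)) - action_cost (B i) (a i)"
        by (subst avg_add[OF fU]) (simp add: avg_const[OF fU] expectation_avg[OF fU U(2) fi])
      also have "\<dots> \<le> ?O (\<lambda>x. utility B (\<pi> x) (v(i := x))) - action_cost (B i) (a i)"
        using \<pi>(2) by (intro diff_right_mono expectation_mono_finite fi)
      finally show ?thesis
        using \<pi>(1) iE False
        by (intro exI[of _ "Advance i (return_pmf (a i)) (\<lambda>_. \<pi>)"])
          (simp add: T'_def D_def[symmetric])
    qed
  qed
qed

section \<open>Choosing the commitment\<close>

primrec committed_law :: "box \<Rightarrow> action \<Rightarrow> real pmf" where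
  "committed_law b Open = map_pmf (W_open b) (law b)"
| "committed_law b Grab = return_pmf (mean b)"

lemma finite_committed_law: "wf_box b \<Longrightarrow> finite (set_pmf (committed_law b a))"
  by (cases a) (simp_all add: wf_box_def)

text \<open>
  \<open>G\<close> is the set of boxes committed to Grab so far. If it spans \<open>i\<close>, then \<open>i\<close> can be exchanged for a
  grabbed box of at least its mean, so only thresholds above the mean matter and opening loses
  nothing. Charging a loss only to boxes outside the span keeps \<open>G\<close> independent.
\<close>

lemma exists_action:
  fixes v :: "'a \<Rightarrow> real"
  assumes M: "matroid E F" and b: "wf_box b" "normalized b"
    and p: "p \<in> {0..1}" "semilocal b (h'_index b) \<alpha> \<beta> p" and \<alpha>: "0 \<le> \<alpha>" "\<alpha> \<le> 1"
    and U: "finite U" "\<forall>j\<in>U. finite (set_pmf (D j))"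
    and G: "G \<in> F" "i \<notin> G" "G \<subseteq> U"
    and heavy: "\<And>j. j \<in> G \<Longrightarrow> D j = return_pmf (m j) \<and> mean b \<le> m j"
  defines "\<Phi> d \<equiv> avg U v D (\<lambda>w. measure_pmf.expectation d (\<lambda>x. best F {} (w(i := x))))"
  defines "d \<equiv> map_pmf ((*) \<alpha>) (star_law b)"
  shows "\<Phi> d \<le> \<Phi> (committed_law b Open) \<or>
    insert i G \<in> F \<and> \<Phi> d \<le> \<Phi> (committed_law b Grab) + \<beta> * mean b"
proof -
  have e: "{} \<in> F" using M by (simp add: matroid_def)
  note int = integrable_law[OF b(1)]
  show ?thesis
  proof (cases "insert i G \<in> F")
    case False
    have "\<Phi> d \<le> \<Phi> (committed_law b Open)"
      unfolding \<Phi>_def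
    proof (rule avg_mono[OF U])
      fix w assume w: "\<And>j. j \<notin> U \<Longrightarrow> w j = v j" "\<And>j. j \<in> U \<Longrightarrow> w j \<in> set_pmf (D j)"
      have "mean b \<le> w j" if "j \<in> G" for j
        using w(2)[of j] heavy[OF that] that G by auto
      then have spanned: "best F {} (w(i := mean b)) \<le> best F {} (w(i := x))" for x
        using best_spanned_le[OF M G(1) False] by simp
      show "measure_pmf.expectation d (\<lambda>x. best F {} (w(i := x)))
          \<le> measure_pmf.expectation (committed_law b Open) (\<lambda>x. best F {} (w(i := x)))"
      proof (cases rule: best_update_cases[OF M e, of i w])
        case (2 c)
        then show ?thesis by simp
      next
        case (3 c y)
        \<comment> \<open>A weight below both \<open>mean b\<close> and \<open>y\<close> leaves only
          \<open>c + y\<close> on the right of \<open>spanned\<close>, which forces the threshold to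
          be at least the mean.\<close>
        with spanned[of "min (mean b) y - 1"] have "mean b \<le> y"
          by (auto simp: max_def min_def split: if_splits)
        from open_lossless_above_mean[OF b this \<alpha>] show ?thesis
          by (simp add: 3 d_def star_law_def int)
      qed simp
    qed
    then show ?thesis by simp
  next
    case True
    then have i: "insert i {} \<in> F" using matroid_subset[OF M] by auto
    have "\<Phi> d \<le> avg U v D (\<lambda>w.
        (1 - p) * measure_pmf.expectation (committed_law b Open) (\<lambda>x. best F {} (w(i := x)))
      + (p * measure_pmf.expectation (committed_law b Grab) (\<lambda>x. best F {} (w(i := x)))
      + p * (\<beta> * mean b)))"
      unfolding \<Phi>_def
    proof (rule avg_mono[OF U])
      fix w
      show "measure_pmf.expectation d (\<lambda>x. best F {} (w(i := x)))
        \<le> (1 - p) * measure_pmf.expectation (committed_law b Open) (\<lambda>x. best F {} (w(i := x)))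
          + (p * measure_pmf.expectation (committed_law b Grab) (\<lambda>x. best F {} (w(i := x)))
          + p * (\<beta> * mean b))"
      proof (cases rule: best_update_cases[OF M e, of i w])
        case (2 c)
        with i show ?thesis by simp
      next
        case (3 c y)
        then show ?thesis
          using p(2)[unfolded semilocal_def, rule_format, of y]
          by (simp add: d_def star_law_def int algebra_simps)
      qed simp
    qed
    also have "\<dots> = (1 - p) * \<Phi> (committed_law b Open)
        + p * (\<Phi> (committed_law b Grab) + \<beta> * mean b)"
      unfolding \<Phi>_def by (simp only: avg_add[OF U] avg_cmult[OF U] avg_const[OF U] distrib_left)
    finally have le: "\<Phi> d \<le> (1 - p) * \<Phi> (committed_law b Open)
        + p * (\<Phi> (committed_law b Grab) + \<beta> * mean b)" .
    \<comment> \<open>The average over the other boxes is linear, so \<open>\<Phi> d\<close> is at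
      most a convex combination of two numbers, hence at most one of them. Here the random choice
      with probability \<open>p\<close> becomes a deterministic action.\<close>
    have "\<Phi> d \<le> \<Phi> (committed_law b Open) \<or> \<Phi> d \<le> \<Phi> (committed_law b Grab) + \<beta> * mean b"
    proof (rule ccontr)
      assume "\<not> ?thesis"
      then have "(1 - p) * \<Phi> (committed_law b Open)
          + p * (\<Phi> (committed_law b Grab) + \<beta> * mean b) < \<Phi> d"
        using p(1) by (intro convex_bound_lt) auto
      with le show False by simp
    qed
    with True show ?thesis by simp
  qed
qed

text \<open>The induction removes the box of least mean from \<open>P\<close> and decides it last,
  so all boxes grabbed before it are at least as heavy, as \<open>exists_action\<close> requires.
  Undecided boxes keep the scaled surrogate; \<open>G\<close> collects the boxes charged with a
  loss.\<close>

lemma exists_commitment: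
  assumes M: "matroid E F" and b: "\<And>i. i \<in> E \<Longrightarrow> wf_box (B i) \<and> normalized (B i)"
    and sl: "\<And>i. i \<in> E \<Longrightarrow> \<exists>p\<in>{0..1}. semilocal (B i) (h'_index (B i)) \<alpha> \<beta> p"
    and \<alpha>: "0 \<le> \<alpha>" "\<alpha> \<le> 1"
  defines "S \<equiv> \<lambda>i. map_pmf ((*) \<alpha>) (star_law (B i))"
  assumes "P \<subseteq> E" and "\<And>i j. j \<in> P \<Longrightarrow> i \<in> E - P \<Longrightarrow> mean (B i) \<le> mean (B j)"
  shows "\<exists>a G. G \<in> F \<and> G \<subseteq> P \<and> (\<forall>j\<in>G. a j = Grab) \<and>
    avg E v S (best F {}) \<le>
      avg E v (\<lambda>j. if j \<in> P then committed_law (B j) (a j) else S j) (best F {})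
        + \<beta> * (\<Sum>j\<in>G. mean (B j))"
  using assms(7,8)
proof (induction "card P" arbitrary: P)
  case 0
  have "finite P" using 0(2) M finite_subset by (auto simp: matroid_def)
  with 0 have "P = {}" by simp
  moreover have "{} \<in> F" using M by (simp add: matroid_def)
  ultimately show ?case by (intro exI[of _ "\<lambda>_. Open"] exI[of _ "{}"]) simp
next
  case (Suc n)
  have fE: "finite E" using M by (simp add: matroid_def)
  have fP: "finite P" "P \<noteq> {}" using Suc(2) by (auto intro: card_ge_0_finite)
  then obtain i where i: "i \<in> P" "\<And>j. j \<in> P \<Longrightarrow> mean (B i) \<le> mean (B j)"
    using arg_min_if_finite[of P "\<lambda>i. mean (B i)"] by (metis linorder_not_le)
  have iE: "i \<in> E" using i Suc.prems by auto
  have "\<exists>a G. G \<in> F \<and> G \<subseteq> P - {i} \<and> (\<forall>j\<in>G. a j = Grab) \<and>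
    avg E v S (best F {}) \<le>
      avg E v (\<lambda>j. if j \<in> P - {i} then committed_law (B j) (a j) else S j) (best F {})
        + \<beta> * (\<Sum>j\<in>G. mean (B j))"
  proof (rule Suc.hyps(1))
    show "n = card (P - {i})" using Suc.hyps(2) fP i by simp
    show "P - {i} \<subseteq> E" using Suc.prems by auto
    show "mean (B k) \<le> mean (B j)" if "j \<in> P - {i}" "k \<in> E - (P - {i})" for k j
      using that i Suc.prems(2)[of j k] by (cases "k = i") auto
  qed
  then obtain a G where aG: "G \<in> F" "G \<subseteq> P - {i}" "\<And>j. j \<in> G \<Longrightarrow> a j = Grab"
    "avg E v S (best F {}) \<le>
      avg E v (\<lambda>j. if j \<in> P - {i} then committed_law (B j) (a j) else S j) (best F {})
        + \<beta> * (\<Sum>j\<in>G. mean (B j))"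
    by blast
  define D where "D = (\<lambda>j. if j \<in> P - {i} then committed_law (B j) (a j) else S j)"
  define \<Phi> where "\<Phi> d = avg (E - {i}) v D
      (\<lambda>w. measure_pmf.expectation d (\<lambda>x. best F {} (w(i := x))))" for d
  have fS: "finite (set_pmf (S j))" if "j \<in> E" for j
    using b[OF that] by (simp add: S_def finite_star_law)
  then have fD: "\<forall>j\<in>E. finite (set_pmf (D j))"
    using b by (simp add: D_def finite_committed_law)
  \<comment> \<open>Isolates coordinate \<open>i\<close>: its law enters only through the argument
    of \<open>\<Phi>\<close>, in which \<open>exists_action\<close> compares the
    alternatives.\<close>
  have upd: "avg E v (D(i := d)) (best F {}) = \<Phi> d" if "finite (set_pmf d)" for d
  proof -
    have E: "E = insert i (E - {i})" using iE by auto
    have "avg E v (D(i := d)) (best F {}) = avg (E - {i}) v (D(i := d))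
        (\<lambda>w. measure_pmf.expectation d (\<lambda>x. best F {} (w(i := x))))"
      using fE fD that by (subst E, subst avg_insert) auto
    also have "\<dots> = \<Phi> d" unfolding \<Phi>_def by (rule avg_cong) auto
    finally show ?thesis .
  qed
  have "D i = S i" by (simp add: D_def)
  then have start: "avg E v D (best F {}) = \<Phi> (S i)"
    using upd[OF fS[OF iE]] fun_upd_triv[of D i] by simp
  have new: "avg E v (\<lambda>j. if j \<in> P then committed_law (B j) ((a(i := c)) j) else S j) (best F {})
      = \<Phi> (committed_law (B i) c)" for c
  proof -
    have "(\<lambda>j. if j \<in> P then committed_law (B j) ((a(i := c)) j) else S j)
        = D(i := committed_law (B i) c)"
      using i by (auto simp: D_def fun_eq_iff)
    then show ?thesis using upd finite_committed_law b[OF iE] by simp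
  qed
  obtain p where p: "p \<in> {0..1}" "semilocal (B i) (h'_index (B i)) \<alpha> \<beta> p"
    using sl[OF iE] by auto
  have "\<Phi> (S i) \<le> \<Phi> (committed_law (B i) Open) \<or>
    insert i G \<in> F \<and> \<Phi> (S i) \<le> \<Phi> (committed_law (B i) Grab) + \<beta> * mean (B i)"
    unfolding \<Phi>_def S_def
  proof (rule exists_action[OF M _ _ p \<alpha>, where m = "\<lambda>j. mean (B j)"])
    show "G \<subseteq> E - {i}" using aG Suc.prems by auto
    show "D j = return_pmf (mean (B j)) \<and> mean (B i) \<le> mean (B j)" if "j \<in> G" for j
      using that aG i by (auto simp: D_def)
  qed (use b iE fE fD aG in auto)
  then show ?case
  proof
    assume "\<Phi> (S i) \<le> \<Phi> (committed_law (B i) Open)"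
    then have "avg E v S (best F {})
      \<le> avg E v (\<lambda>j. if j \<in> P then committed_law (B j) ((a(i := Open)) j) else S j) (best F {})
        + \<beta> * (\<Sum>j\<in>G. mean (B j))"
      using aG(4)[folded D_def] unfolding start new by linarith
    moreover have "\<forall>j\<in>G. (a(i := Open)) j = Grab" "G \<subseteq> P" using aG by auto
    ultimately show ?thesis using aG(1) by blast
  next
    assume *: "insert i G \<in> F \<and> \<Phi> (S i) \<le> \<Phi> (committed_law (B i) Grab) + \<beta> * mean (B i)"
    have "finite G" "i \<notin> G" using aG(2) finite_subset[OF aG(2)] fP by auto
    then have "\<beta> * (\<Sum>j\<in>insert i G. mean (B j)) = \<beta> * mean (B i) + \<beta> * (\<Sum>j\<in>G. mean (B j))"
      by (simp add: distrib_left)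
    with * have "avg E v S (best F {})
      \<le> avg E v (\<lambda>j. if j \<in> P then committed_law (B j) ((a(i := Grab)) j) else S j) (best F {})
        + \<beta> * (\<Sum>j\<in>insert i G. mean (B j))"
      using aG(4)[folded D_def] unfolding start new by linarith
    moreover have "\<forall>j\<in>insert i G. (a(i := Grab)) j = Grab" "insert i G \<subseteq> P"
      using aG i by auto
    ultimately show ?thesis using * by blast
  qed
qed

section \<open>The commitment gap\<close>

lemma feasible_mono:
  assumes "\<And>i. C i \<subseteq> C' i"
  shows "feasible E F C \<pi> T A \<Longrightarrow> feasible E F C' \<pi> T A"
proof (induction \<pi> arbitrary: T A)
  case (Advance i q k)
  then show ?case using assms[of i] Advance.IH[OF rangeI rangeI] by auto
qed auto

lemma utility_le_opt_value:
  assumes "finite E" "\<And>i. i \<in> E \<Longrightarrow> wf_box (B i)" "feasible E F C \<pi> {} {}"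
  shows "utility B \<pi> (\<lambda>_. 0) \<le> opt_value E F B C"
  unfolding opt_value_def using assms
  by (intro cSUP_upper bdd_above_utility) auto

lemma opt_value_le:
  assumes "\<And>\<pi>. feasible E F C \<pi> {} {} \<Longrightarrow> utility B \<pi> (\<lambda>_. 0) \<le> u"
  shows "opt_value E F B C \<le> u"
  unfolding opt_value_def
proof (rule cSUP_least)
  have "feasible E F C Stop {} {}" by simp
  then show "{\<pi>. feasible E F C \<pi> {} {}} \<noteq> {}" by blast
qed (use assms in auto)

lemma opt_value_mono:
  assumes "finite E" "\<And>i. i \<in> E \<Longrightarrow> wf_box (B i)" "\<And>i. C i \<subseteq> C' i"
  shows "opt_value E F B C \<le> opt_value E F B C'"
  using assms by (intro opt_value_le utility_le_opt_value) (auto intro: feasible_mono)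

lemma opt_value_nonneg:
  assumes "finite E" "\<And>i. i \<in> E \<Longrightarrow> wf_box (B i)"
  shows "0 \<le> opt_value E F B C"
  using utility_le_opt_value[OF assms, where \<pi> = Stop] by simp

text \<open>Grab the members of \<open>G\<close> one by one and accept each at once. This bounds the
  loss charged to an independent set of grabbed boxes by a multiple of the optimum.\<close>

lemma OPT_ge_sum_mean:
  assumes M: "matroid E F" and b: "\<And>i. i \<in> E \<Longrightarrow> wf_box (B i)" and G: "G \<in> F"
  shows "(\<Sum>j\<in>G. mean (B j)) \<le> OPT E F B"
proof -
  have "\<exists>\<pi>. feasible E F (\<lambda>_. range return_pmf) \<pi> A A \<and>
      utility B \<pi> v = (\<Sum>j\<in>G - A. mean (B j))" if "A \<subseteq> G" for A v
    using that
  proof (induction "card (G - A)" arbitrary: A v)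
    case 0
    then have "G - A = {}" using matroid_finite(2)[OF M G] by simp
    then show ?case by (intro exI[of _ Stop]) (simp only: feasible.simps utility.simps sum.empty simp_thms)
  next
    case (Suc n)
    then have "G - A \<noteq> {}" by (metis card.empty nat.distinct(1))
    then obtain i where i: "i \<in> G" "i \<notin> A" by auto
    have fG: "finite G" by (rule matroid_finite(2)[OF M G])
    have G': "G - A - {i} = G - insert i A" by auto
    have c: "n = card (G - insert i A)"
      using Suc.hyps(2) i fG card_Suc_Diff1[of "G - A" i] unfolding G' by simp
    obtain \<pi> where \<pi>: "feasible E F (\<lambda>_. range return_pmf) \<pi> (insert i A) (insert i A)"
      "utility B \<pi> (v(i := mean (B i))) = (\<Sum>j\<in>G - insert i A. mean (B j))"
      using Suc.hyps(1)[OF c, of "v(i := mean (B i))"] Suc.prems i by blast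
    have "i \<in> E" "insert i A \<in> F"
      using i G M matroid_subset[OF M G, of "insert i A"] Suc.prems by (auto simp: matroid_def)
    moreover have "(\<Sum>j\<in>G - A. mean (B j)) = mean (B i) + (\<Sum>j\<in>G - insert i A. mean (B j))"
      using i fG sum.remove[of "G - A" i "\<lambda>j. mean (B j)"] unfolding G' by simp
    ultimately show ?case
      using \<pi> i by (intro exI[of _ "Advance i (return_pmf Grab) (\<lambda>_ _. Accept i \<pi>)"]) simp
  qed
  from this[of "{}" "\<lambda>_. 0"] obtain \<pi> where "feasible E F (\<lambda>_. range return_pmf) \<pi> {} {}"
    "utility B \<pi> (\<lambda>_. 0) = (\<Sum>j\<in>G. mean (B j))" by auto
  with utility_le_opt_value[where E = E and F = F and B = B and \<pi> = \<pi>] b M show ?thesis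
    by (simp add: OPT_def matroid_def)
qed

text \<open>Nonnegative values of mean 0 vanish on the support, so without a positive mean no policy
  has positive utility.\<close>

lemma exists_mean_pos:
  assumes "finite E" "\<And>i. i \<in> E \<Longrightarrow> wf_box (B i)" "0 < OPT E F B"
  shows "\<exists>i\<in>E. 0 < mean (B i)"
proof (rule ccontr)
  assume "\<not> ?thesis"
  then have mean: "mean (B i) \<le> 0" if "i \<in> E" for i
    using that by force
  have "x \<le> 0" if i: "i \<in> E" and x: "x \<in> set_pmf (outcome (B i) a)" for i a x
  proof (cases a)
    case Open
    have wf: "wf_box (B i)" by (rule assms(2)[OF i])
    have "pmf (law (B i)) x * x \<le> (\<Sum>z\<in>set_pmf (law (B i)). pmf (law (B i)) z * z)"
      using wf x Open by (intro member_le_sum) (auto simp: wf_box_def)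
    also have "\<dots> = mean (B i)"
      using wf unfolding mean_def
      by (subst integral_measure_pmf[of "set_pmf (law (B i))"]) (auto simp: wf_box_def)
    also have "\<dots> \<le> 0" by (rule mean[OF i])
    finally show ?thesis
      using x Open pmf_positive[of x "law (B i)"] by (simp add: mult_le_0_iff)
  qed (use mean[OF i] x in simp)
  then have "utility B \<pi> (\<lambda>_. 0) \<le> (\<Sum>i\<in>E - {}. 0)"
    if "feasible E F (\<lambda>_. range return_pmf) \<pi> {} {}" for \<pi>
    using that assms by (intro utility_le[where T = "{}"]) auto
  then have "OPT E F B \<le> 0" unfolding OPT_def by (intro opt_value_le) simp
  with assms(3) show False by simp
qed

text \<open>Chains the surrogate upper bound, the box-by-box exchange and the index policy; the
  charge to \<open>G\<close> is absorbed into \<open>\<beta> * OPT E F B\<close>.\<close>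

lemma exists_good_commitment:
  assumes M: "matroid E F" and b: "\<And>i. i \<in> E \<Longrightarrow> wf_box (B i) \<and> normalized (B i)"
    and sl: "\<And>i. i \<in> E \<Longrightarrow> \<exists>p\<in>{0..1}. semilocal (B i) (h'_index (B i)) \<alpha> \<beta> p"
    and \<alpha>: "0 \<le> \<alpha>" "\<alpha> \<le> 1" and \<beta>: "0 \<le> \<beta>"
  shows "\<exists>a. (\<alpha> - \<beta>) * OPT E F B \<le> OPT_committed E F B (\<lambda>i. return_pmf (a i))"
proof -
  have fE: "finite E" and eF: "{} \<in> F" using M by (auto simp: matroid_def)
  define S where "S = (\<lambda>i. star_law (B i))"
  have "\<exists>a G. G \<in> F \<and> G \<subseteq> E \<and> (\<forall>j\<in>G. a j = Grab) \<and>
    avg E (\<lambda>_. 0) (\<lambda>i. map_pmf ((*) \<alpha>) (S i)) (best F {}) \<le>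
      avg E (\<lambda>_. 0) (\<lambda>j. if j \<in> E then committed_law (B j) (a j)
        else map_pmf ((*) \<alpha>) (S j)) (best F {}) + \<beta> * (\<Sum>j\<in>G. mean (B j))"
    unfolding S_def by (rule exists_commitment[OF M]) (use b sl \<alpha> in auto)
  then obtain a G where aG: "G \<in> F" "avg E (\<lambda>_. 0) (\<lambda>i. map_pmf ((*) \<alpha>) (S i)) (best F {}) \<le>
      avg E (\<lambda>_. 0) (\<lambda>j. if j \<in> E then committed_law (B j) (a j)
        else map_pmf ((*) \<alpha>) (S j)) (best F {}) + \<beta> * (\<Sum>j\<in>G. mean (B j))"
    by blast
  have "OPT E F B \<le> avg E (\<lambda>_. 0) S (best F {})"
    unfolding OPT_def S_def
  proof (rule opt_value_le)
    fix \<pi> assume "feasible E F (\<lambda>_. range return_pmf) \<pi> {} {}"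
    then have "utility B \<pi> (\<lambda>_. 0) \<le> avg (E - {}) (\<lambda>_. 0) (\<lambda>i. star_law (B i)) (best F {})"
      by (intro utility_le_avg_best[OF M]) (use b eF in auto)
    then show "utility B \<pi> (\<lambda>_. 0) \<le> avg E (\<lambda>_. 0) (\<lambda>i. star_law (B i)) (best F {})" by simp
  qed
  then have "\<alpha> * OPT E F B \<le> \<alpha> * avg E (\<lambda>_. 0) S (best F {})"
    by (rule mult_left_mono[OF _ \<alpha>(1)])
  also have "\<dots> = avg E (\<lambda>_. 0) S (\<lambda>w. \<alpha> * best F {} w)"
    using b by (subst avg_cmult) (auto simp: fE S_def finite_star_law)
  also have "\<dots> = avg E (\<lambda>_. 0) (\<lambda>i. map_pmf ((*) \<alpha>) (S i)) (best F {})"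
    by (subst avg_map) (simp_all add: fE best_scale[OF matroid_finite(1)[OF M] eF \<alpha>(1)])
  also note aG(2)
  finally have "\<alpha> * OPT E F B \<le> avg E (\<lambda>_. 0) (\<lambda>j. if j \<in> E then committed_law (B j) (a j)
        else map_pmf ((*) \<alpha>) (S j)) (best F {}) + \<beta> * (\<Sum>j\<in>G. mean (B j))" .
  moreover have "\<beta> * (\<Sum>j\<in>G. mean (B j)) \<le> \<beta> * OPT E F B"
    using b by (intro mult_left_mono[OF _ \<beta>] OPT_ge_sum_mean[OF M _ aG(1)]) auto
  ultimately have upper: "\<alpha> * OPT E F B \<le> avg E (\<lambda>_. 0) (\<lambda>j. if j \<in> E then committed_law (B j) (a j)
        else map_pmf ((*) \<alpha>) (S j)) (best F {}) + \<beta> * OPT E F B"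
    by linarith
  \<comment> \<open>A grabbed box costs 0, and its mean is an index that solves the equation without
    cutting off the value.\<close>
  define g where "g i = (case a i of Open \<Rightarrow> g_index (B i) | Grab \<Rightarrow> mean (B i))" for i
  have "\<exists>\<pi>. feasible E F (\<lambda>i. {return_pmf (a i)}) \<pi> {} {} \<and>
      avg (E - {}) (\<lambda>_. 0) (\<lambda>i. map_pmf (\<lambda>x. min x (g i)) (outcome (B i) (a i))) (best F {})
        \<le> utility B \<pi> (\<lambda>_. 0)"
  proof (rule exists_index_policy[OF M])
    fix i assume i: "i \<in> E"
    show "finite (set_pmf (outcome (B i) (a i)))" using b[OF i] finite_outcome by auto
    show "action_cost (B i) (a i)
        = measure_pmf.expectation (outcome (B i) (a i)) (\<lambda>x. max (x - g i) 0)"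
      using g_index_solves[of "B i"] b[OF i] by (cases "a i") (auto simp: g_def)
  qed (auto simp: eF)
  then obtain \<pi> where \<pi>: "feasible E F (\<lambda>i. {return_pmf (a i)}) \<pi> {} {}"
    "avg E (\<lambda>_. 0) (\<lambda>i. map_pmf (\<lambda>x. min x (g i)) (outcome (B i) (a i))) (best F {})
      \<le> utility B \<pi> (\<lambda>_. 0)" by auto
  have "map_pmf (\<lambda>x. min x (g i)) (outcome (B i) (a i)) = committed_law (B i) (a i)" for i
    by (cases "a i") (simp_all add: g_def W_open_def[abs_def])
  then have "avg E (\<lambda>_. 0) (\<lambda>j. if j \<in> E then committed_law (B j) (a j)
        else map_pmf ((*) \<alpha>) (S j)) (best F {}) \<le> utility B \<pi> (\<lambda>_. 0)"
    using \<pi>(2) by (subst avg_cong[where D' = "\<lambda>j. committed_law (B j) (a j)"]) auto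
  also have "\<dots> \<le> OPT_committed E F B (\<lambda>i. return_pmf (a i))"
    unfolding OPT_committed_def using fE b \<pi>(1) by (intro utility_le_opt_value) auto
  finally show ?thesis using upper by (intro exI[of _ a]) (simp add: algebra_simps)
qed

theorem theorem10:
  fixes n :: nat and F :: "nat set set" and B :: "nat \<Rightarrow> box"
    and h :: "nat \<Rightarrow> real" and \<alpha> \<beta> :: real
  assumes "\<alpha> > \<beta>" and "\<beta> \<ge> 0"
    and "matroid {1..n} F"
    and "\<forall>i\<in>{1..n}. wf_box (B i) \<and> normalized (B i)"
    and "\<forall>i\<in>{1..n}. h i = max (mean (B i)) (h'_index (B i)) \<or> (\<alpha> \<le> 1 \<and> h i = h'_index (B i))"
    and "\<forall>i\<in>{1..n}. \<exists>p\<in>{0..1}. semilocal (B i) (h i) \<alpha> \<beta> p"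
    and "OPT {1..n} F B \<noteq> 0"
  shows "CG {1..n} F B \<ge> \<alpha> - \<beta>"
proof -
  define E where "E = {1..n}"
  have fE: "finite E" by (simp add: E_def)
  have M: "matroid E F" using assms(3) by (simp add: E_def)
  have b: "wf_box (B i)" "normalized (B i)" if "i \<in> E" for i
    using assms(4) that by (auto simp: E_def)
  have h': "h'_index (B i) \<le> mean (B i)" if "i \<in> E" for i
    by (rule h'_index_le_mean[OF b[OF that]])
  have pos: "0 < OPT E F B"
  proof -
    have "0 \<le> OPT E F B" unfolding OPT_def using fE b(1) by (rule opt_value_nonneg)
    then show ?thesis using assms(7) by (simp add: E_def)
  qed
  have "\<exists>a. (\<alpha> - \<beta>) * OPT E F B \<le> OPT_committed E F B (\<lambda>i. return_pmf (a i))"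
  proof (cases "\<alpha> \<le> 1")
    case True
    show ?thesis
    proof (rule exists_good_commitment[OF M _ _ _ True assms(2)])
      fix i assume i: "i \<in> E"
      then obtain p where "p \<in> {0..1}" "semilocal (B i) (h i) \<alpha> \<beta> p"
        using assms(6) unfolding E_def by blast
      moreover have "h'_index (B i) \<le> h i" using assms(5)[rule_format, of i] i by (auto simp: E_def)
      moreover have "0 \<le> \<alpha>" using assms(1,2) by simp
      ultimately show "\<exists>p\<in>{0..1}. semilocal (B i) (h'_index (B i)) \<alpha> \<beta> p"
        using semilocal_antimono[OF b(1)[OF i]] by blast
    qed (use b assms in auto)
  next
    case False
    \<comment> \<open>Now \<open>h\<close> is the mean. Lowering the factor to 1 and the loss by the
      same amount preserves the guarantee: \<open>1 - \<beta>' = \<alpha> - \<beta>\<close>.\<close>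
    define \<beta>' where "\<beta>' = \<beta> - (\<alpha> - 1)"
    have sl: "\<exists>p\<in>{0..1}. semilocal (B i) (mean (B i)) \<alpha> \<beta> p \<and> semilocal (B i) (mean (B i)) 1 \<beta>' p"
      if i: "i \<in> E" for i
    proof -
      obtain p where p: "p \<in> {0..1}" "semilocal (B i) (h i) \<alpha> \<beta> p"
        using assms(6) i unfolding E_def by blast
      moreover have "h i = mean (B i)" using assms(5)[rule_format, of i] i False h'[OF i] by (auto simp: E_def)
      ultimately show ?thesis
        using semilocal_rescale[OF b(1)[OF i], of p \<alpha> \<beta>] False by (auto simp: \<beta>'_def)
    qed
    \<comment> \<open>Nonnegativity of \<open>\<beta>'\<close> comes from
      \<open>semilocal_loss_ge\<close> at a box of positive mean, which exists because the optimum
      is positive.\<close>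
    obtain i where i: "i \<in> E" "0 < mean (B i)" using exists_mean_pos[OF fE _ pos] b(1) by blast
    have "0 \<le> \<beta>'"
      using sl[OF i(1)] semilocal_loss_ge[OF b(1)[OF i(1)] _ _ _ assms(2) i(2)] False
      by (auto simp: \<beta>'_def)
    then have "\<exists>a. (1 - \<beta>') * OPT E F B \<le> OPT_committed E F B (\<lambda>i. return_pmf (a i))"
    proof (intro exists_good_commitment[OF M])
      fix i assume i: "i \<in> E"
      with sl[OF i] show "\<exists>p\<in>{0..1}. semilocal (B i) (h'_index (B i)) 1 \<beta>' p"
        using semilocal_antimono[OF b(1)[OF i] _ h'[OF i], of 1 \<beta>'] zero_le_one by blast
    qed (use b in auto)
    then show ?thesis by (simp add: \<beta>'_def)
  qed
  then obtain a where a: "(\<alpha> - \<beta>) * OPT E F B \<le> OPT_committed E F B (\<lambda>i. return_pmf (a i))" ..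
  \<comment> \<open>The supremum in \<open>CG\<close> is over reals and needs a bound: every
    commitment is dominated by policies free to choose any distribution over actions at each
    box.\<close>
  have "bdd_above (range (\<lambda>c. OPT_committed E F B c / OPT E F B))"
  proof (rule bdd_aboveI)
    fix r assume "r \<in> range (\<lambda>c. OPT_committed E F B c / OPT E F B)"
    then obtain c where "r = OPT_committed E F B c / OPT E F B" by auto
    moreover have "OPT_committed E F B c \<le> opt_value E F B (\<lambda>_. UNIV)"
      unfolding OPT_committed_def using fE b by (intro opt_value_mono) auto
    ultimately show "r \<le> opt_value E F B (\<lambda>_. UNIV) / OPT E F B"
      using pos by (simp add: divide_right_mono)
  qed
  then have "OPT_committed E F B (\<lambda>i. return_pmf (a i)) / OPT E F B \<le> CG E F B"
    unfolding CG_def by (intro cSUP_upper) auto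
  moreover have "\<alpha> - \<beta> \<le> OPT_committed E F B (\<lambda>i. return_pmf (a i)) / OPT E F B"
    using a pos by (simp add: pos_le_divide_eq)
  ultimately show ?thesis by (simp add: E_def)
qed

end
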